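(* Let $p \in [0,1]$, let $X$ be a real-valued random variable, and let $(B_n, n \geq 0)$ be a one-sided limit order book Markov chain with parameters $p$ and $X$ and price function $\pi$ (as defined in the context), started from an arbitrary initial book. Assume that $p > 1/2$ and that $\mathbb{E} X$ exists in $(-\infty,\infty)$. (1) If $\mathbb{E} X > 0$, then $\pi(B_n) \to +\infty$ almost surely as $n \to \infty$. (2) Suppose instead that $\mathbb{E} X < 0$ and $\mathbb{P}(X > 0) > 0$, and let $a = \inf_{\theta \geq 0} \mathbb{E}(e^{\theta X}) \in (0,1]$. If $p > 1/(1+a)$, then $\pi(B_n) \to +\infty$ almost surely as $n\to\infty$; if $p < 1/(1+a)$, then $\pi(B_n) \to -\infty$ almost surely as $n\to\infty$.
   Context: A book is a finite point measure on $\mathbb{R}$, i.e. a finite (possibly empty) sum of Dirac masses $\delta_x$, $x \in \mathbb{R}$ (with multiplicity). Let $\mathcal{B}$ be the set of books. For $\beta \in \mathcal{B}$, $|\beta|$ denotes its total mass (number of points counted with multiplicity), and the price is $\pi(\beta) = \max\{x \in \mathbb{R} : \beta(\{x\}) > 0\}$ if $|\beta| > 0$, and $\pi(\beta) = 0$ if $|\beta| = 0$. The one-sided limit order book Markov chain with parameters $p$ and $X$ is the $\mathcal{B}$-valued Markov chain $(B_n, n \ge 0)$ with the following transitions: for every $\beta \in \mathcal{B}$ and every measurable $f : \mathcal{B} \to [0,\infty)$, $$\mathbb{E}[f(B_{n+1}) \mid B_n = \beta] = f(\delta_0)\mathbf{1}_{\{|\beta| = 0\}} + p\,\mathbb{E}[f(\beta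 + \delta_{\pi(\beta)+X})]\mathbf{1}_{\{|\beta|>0\}} + (1-p) f(\beta - \delta_{\pi(\beta)})\mathbf{1}_{\{|\beta|>0\}}.$$ That is, from the empty book the chain moves to $\delta_0$; from a non-empty book, with probability $p$ a point is added at $\pi(\beta)+X$ (with a fresh independent copy of $X$), and with probability $1-p$ one point located at the price $\pi(\beta)$ is removed. The expectations $\mathbb{E}(e^{\theta X})$ may equal $+\infty$ for $\theta>0$. *)

theory Defs
  imports "HOL-Probability.Probability"
begin

text \<open>
  A book, i.e. a finite sum of Dirac masses on the real line, is represented by the finite multiset
  of the locations of its points: the sum of Dirac masses at \<open>x\<^sub>1, \<dots>, x\<^sub>n\<close> is the multiset
  \<open>{#x\<^sub>1, \<dots>, x\<^sub>n#}\<close>, so \<open>count \<beta> x\<close> is the mass of \<open>{x}\<close> and \<open>size \<beta>\<close> the total mass.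
\<close>

type_synonym book = "real multiset"

definition book_mass :: "book \<Rightarrow> real set \<Rightarrow> nat" where
  "book_mass \<beta> A = size (filter_mset (\<lambda>x. x \<in> A) \<beta>)"

text \<open>
  The usual measurable structure on point measures: the coarsest one making \<open>\<beta> \<mapsto> \<beta>(A)\<close>
  measurable for every Borel set \<open>A\<close>.
\<close>

definition book_algebra :: "book measure" where
  "book_algebra = sigma UNIV {{\<beta>. book_mass \<beta> A = k} | A k. A \<in> sets borel}"

definition price :: "book \<Rightarrow> real" where
  "price \<beta> = (if size \<beta> > 0 then Max {x. count \<beta> x > 0} else 0)"

text \<open>
  The random variable \<open>X\<close> lives on its own probability space \<open>N\<close>; only its law matters below.
\<close>

definition lob_transition ::
  "real \<Rightarrow> 'v measure \<Rightarrow> ('v \<Rightarrow> real) \<Rightarrow> (book \<Rightarrow> ennreal) \<Rightarrow> book \<Rightarrow> ennreal" where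
  "lob_transition p N X f \<beta> =
     (if size \<beta> = 0 then f {#0#}
      else ennreal p * (\<integral>\<^sup>+ v. f (\<beta> + {#price \<beta> + X v#}) \<partial>N)
           + ennreal (1 - p) * f (\<beta> - {#price \<beta>#}))"

definition natural_filtration ::
  "'w measure \<Rightarrow> (nat \<Rightarrow> 'w \<Rightarrow> book) \<Rightarrow> nat \<Rightarrow> 'w measure" where
  "natural_filtration M B n =
     sigma (space M) {B i -` S \<inter> space M | i S. i \<le> n \<and> S \<in> sets book_algebra}"

text \<open>
  No condition is imposed on \<open>B 0\<close>, which may be any deterministic or random book.
\<close>

definition one_sided_lob_chain ::
  "real \<Rightarrow> 'v measure \<Rightarrow> ('v \<Rightarrow> real) \<Rightarrow> 'w measure \<Rightarrow> (nat \<Rightarrow> 'w \<Rightarrow> book) \<Rightarrow> bool" where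
  "one_sided_lob_chain p N X M B \<longleftrightarrow>
     prob_space M \<and>
     (\<forall>n. B n \<in> measurable M book_algebra) \<and>
     (\<forall>n. \<forall>f \<in> borel_measurable book_algebra. (\<forall>\<beta>. f \<beta> < \<infinity>) \<longrightarrow>
        (AE \<omega> in M. nn_cond_exp M (natural_filtration M B n) (\<lambda>\<omega>'. f (B (Suc n) \<omega>')) \<omega>
                    = lob_transition p N X f (B n \<omega>)))"

end

theory Submission
  imports Defs
begin

text \<open>
  The points of the book behave like the particles of a branching random walk with geometric
  offspring of mean \<open>p / (1 - p)\<close> and displacement \<open>X\<close>, explored from the highest particle
  downwards. The threshold \<open>p = 1 / (1 + a)\<close> is the point where \<open>a\<close> equals \<open>r = (1 - p) / p\<close>.
  The proof never constructs the tree. It works with Lyapunov functions \<open>V\<close> of the book: if the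
  transition operator maps \<open>V\<close> below \<open>V - g\<close>, then \<open>\<Sum>n. g (B n)\<close> is almost surely finite
  (\<open>lyapunov_summable\<close>), and a supermartingale \<open>V\<close> that is at least 1 on a set \<open>S\<close> bounds the
  probability of ever visiting \<open>S\<close> (\<open>maximal_inequality\<close>). For \<open>s\<close> strictly between \<open>r\<close> and \<open>1\<close>
  the function \<open>s ^ size \<beta>\<close> contracts geometrically in expectation, so the book grows and is
  eventually never empty.

  If \<open>a < r\<close>, choose \<open>\<theta>\<close> with \<open>p E(exp (\<theta> X)) < 1 - p\<close>. Each step from a non-empty book decreases
  \<open>\<Sum>x\<in>#\<beta>. exp (\<theta> x)\<close> in mean by a constant times \<open>exp (\<theta> price)\<close>; hence
  \<open>exp (\<theta> price)\<close> is summable along the chain and the price tends to \<open>-\<infinity>\<close>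
  (\<open>price_at_bot\<close>).

  For the limit \<open>+\<infinity>\<close>, suppose that \<open>W\<close> is bounded, nondecreasing, zero on the negative half line,
  positive on the positive one, and \<open>\<nu> W(x) \<le> E W(x + X)\<close> for some \<open>\<nu> > r\<close>. A small multiple \<open>u\<close>
  of \<open>W\<close> then bounds from below the survival probability of the branching random walk killed below
  \<open>0\<close>, in the sense that \<open>V\<^sub>L \<beta> = (\<Prod>x\<in>#\<beta>. 1 - u (x - L))\<close> is a supermartingale for every level
  \<open>L\<close>. Its drift is bounded away from zero when the price is just below \<open>L\<close>, so every bounded
  interval is visited finitely often. The maximal inequality bounds the probability of a price below
  \<open>L\<close> after time \<open>n\<close> by the mean of \<open>V\<^sub>L (B n)\<close>. As \<open>L \<rightarrow> -\<infinity>\<close> the limit of these means is at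
  most the mean of \<open>s ^ size (B n)\<close> for some \<open>s\<close> between \<open>r\<close> and \<open>1\<close>, and the latter vanishes as
  \<open>n \<rightarrow> \<infinity>\<close>; so the price is bounded below and therefore tends to \<open>+\<infinity>\<close> (\<open>price_at_top\<close>).

  It remains to find \<open>W\<close>. When \<open>E X > 0\<close>, a truncated affine function works
  (\<open>subsolution_positive_mean\<close>). When \<open>E X < 0\<close> and \<open>r < a\<close>, restrict \<open>X\<close> to a bounded range and
  tilt it exponentially so that it becomes centred; compactness shows that the mass of the tilted
  measure still exceeds some \<open>\<nu> > r\<close> when the range is large (\<open>centring_tilt\<close>). The positive part of a
  wide parabola is a subsolution for the centred kernel, and \<open>W\<close> is the running supremum of the
  parabola multiplied by \<open>exp (\<theta> x)\<close> (\<open>subsolution_negative_mean\<close>).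
\<close>

section \<open>Measurable functions of a book\<close>

lemma space_book_algebra [simp]: "space book_algebra = UNIV"
  by (simp add: book_algebra_def space_measure_of_conv)

lemma sets_book_mass:
  assumes "A \<in> sets borel"
  shows "{\<beta>. book_mass \<beta> A = k} \<in> sets book_algebra"
  unfolding book_algebra_def using assms by (auto simp: sets_measure_of_conv intro!: sigma_sets.Basic)

lemma measurable_book_mass:
  assumes "A \<in> sets borel"
  shows "(\<lambda>\<beta>. book_mass \<beta> A) \<in> measurable book_algebra (count_space UNIV)"
  using sets_book_mass[OF assms] by (auto simp: measurable_count_space_eq2_countable vimage_def)

lemma book_mass_UNIV: "book_mass \<beta> UNIV = size \<beta>"
  by (simp add: book_mass_def)

lemma measurable_size_book [measurable]: "size \<in> measurable book_algebra (count_space UNIV)"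
  using measurable_book_mass[of UNIV] by (simp add: book_mass_UNIV)

text \<open>
  The sum of \<open>g\<close> over the points is the integral of \<open>g\<close> against the point measure, hence measurable
  by the usual approximation of \<open>g\<close> by simple functions.
\<close>

lemma measurable_sum_over_book:
  fixes g :: "real \<Rightarrow> ennreal"
  assumes "g \<in> borel_measurable borel"
  shows "(\<lambda>\<beta>. \<Sum>x\<in>#\<beta>. g x) \<in> borel_measurable book_algebra"
  using assms
proof (induct rule: borel_measurable_induct)
  case (cong f g)
  then show ?case by (simp cong: image_mset_cong)
next
  case (set A)
  have "(\<Sum>x\<in>#\<beta>. indicator A x) = (of_nat (book_mass \<beta> A) :: ennreal)" for \<beta>
    by (induct \<beta>) (auto simp: book_mass_def indicator_def)
  moreover have "(\<lambda>\<beta>. of_nat (book_mass \<beta> A) :: ennreal) \<in> borel_measurable book_algebra"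
    by (rule measurable_compose[OF measurable_book_mass]) (use set in auto)
  ultimately show ?case by simp
next
  case (mult u c)
  have "(\<Sum>x\<in>#\<beta>. c * u x) = c * (\<Sum>x\<in>#\<beta>. u x)" for \<beta>
    by (simp add: sum_mset_distrib_left)
  then show ?case using mult by simp
next
  case (add u v)
  then show ?case by (simp add: sum_mset.distrib)
next
  case (seq U)
  have "(\<Sum>x\<in>#\<beta>. (SUP i. U i) x) = (SUP i. \<Sum>x\<in>#\<beta>. U i x)" for \<beta>
  proof (induct \<beta>)
    case empty
    then show ?case by simp
  next
    case (add y \<beta>)
    have "incseq (\<lambda>i. \<Sum>x\<in>#\<beta>. U i x)"
      using seq(4) by (auto simp: incseq_def le_fun_def intro!: sum_mset_mono)
    moreover have "incseq (\<lambda>i. U i y)"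
      using seq(4) by (auto simp: incseq_def le_fun_def)
    ultimately show ?case
      using add by (simp add: ennreal_SUP_add image_comp)
  qed
  then show ?case using seq by simp
qed

lemma price_empty [simp]: "price {#} = 0"
  by (simp add: price_def)

lemma price_in_book:
  assumes "\<beta> \<noteq> {#}"
  shows "price \<beta> \<in># \<beta>"
proof -
  have "{x. count \<beta> x > 0} = set_mset \<beta>" by auto
  then show ?thesis
    using assms Max_in[of "set_mset \<beta>"] by (simp add: price_def nonempty_has_size[symmetric])
qed

lemma le_price:
  assumes "x \<in># \<beta>"
  shows "x \<le> price \<beta>"
proof -
  have "{x. count \<beta> x > 0} = set_mset \<beta>" by auto
  then show ?thesis
    using assms Max_ge[of "set_mset \<beta>" x] by (auto simp: price_def nonempty_has_size[symmetric])
qed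

lemma measurable_price [measurable]: "price \<in> borel_measurable book_algebra"
proof (subst borel_measurable_iff_less, intro allI)
  fix t :: real
  \<comment> \<open>the price of the empty book is 0 by convention, so that book is treated separately\<close>
  have "{\<beta> \<in> space book_algebra. price \<beta> < t} =
      (if 0 < t then {\<beta>. book_mass \<beta> UNIV = 0} else {}) \<union>
      ({\<beta>. book_mass \<beta> {t..} = 0} - {\<beta>. book_mass \<beta> UNIV = 0})"
  proof (intro set_eqI)
    fix \<beta> :: book
    show "\<beta> \<in> {\<beta> \<in> space book_algebra. price \<beta> < t} \<longleftrightarrow>
      \<beta> \<in> (if 0 < t then {\<beta>. book_mass \<beta> UNIV = 0} else {}) \<union>
      ({\<beta>. book_mass \<beta> {t..} = 0} - {\<beta>. book_mass \<beta> UNIV = 0})"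
    proof (cases "\<beta> = {#}")
      case True
      then show ?thesis by (simp add: book_mass_def)
    next
      case False
      have "price \<beta> < t \<longleftrightarrow> (\<forall>x\<in>#\<beta>. x < t)"
        using price_in_book[OF False] le_price by fastforce
      then show ?thesis using False
        by (auto simp: book_mass_def filter_mset_eq_conv not_le)
    qed
  qed
  also have "\<dots> \<in> sets book_algebra"
    by (auto intro!: sets_book_mass sets.Diff sets.Un)
  finally show "{\<beta> \<in> space book_algebra. price \<beta> < t} \<in> sets book_algebra" .
qed

lemma measurable_prod_over_book:
  fixes h :: "real \<Rightarrow> real"
  assumes [measurable]: "h \<in> borel_measurable borel" and h: "\<And>x. 0 < h x" "\<And>x. h x \<le> 1"
  shows "(\<lambda>\<beta>. ennreal (\<Prod>x\<in>#\<beta>. h x)) \<in> borel_measurable book_algebra"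
proof -
  have ln: "0 \<le> - ln (h x)" for x using h[of x] by simp
  have "(\<Prod>x\<in>#\<beta>. h x) = exp (- enn2real (\<Sum>x\<in>#\<beta>. ennreal (- ln (h x))))" for \<beta>
  proof -
    have "(\<Sum>x\<in>#\<beta>. ennreal (- ln (h x))) = ennreal (\<Sum>x\<in>#\<beta>. - ln (h x)) \<and> 0 \<le> (\<Sum>x\<in>#\<beta>. - ln (h x))"
      by (induct \<beta>) (use ln in \<open>auto simp: ennreal_plus[symmetric] simp del: ennreal_plus intro: order_trans\<close>)
    moreover have "(\<Prod>x\<in>#\<beta>. h x) = exp (- (\<Sum>x\<in>#\<beta>. - ln (h x)))"
      by (induct \<beta>) (use h in \<open>auto simp: exp_diff exp_minus divide_inverse\<close>)
    ultimately show ?thesis by simp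
  qed
  moreover have "(\<lambda>\<beta>. \<Sum>x\<in>#\<beta>. ennreal (- ln (h x))) \<in> borel_measurable book_algebra"
    by (rule measurable_sum_over_book) measurable
  ultimately show ?thesis by simp
qed

lemma prod_over_book_bounds:
  fixes h :: "real \<Rightarrow> real"
  assumes "\<And>x. x \<in># \<beta> \<Longrightarrow> 0 \<le> h x \<and> h x \<le> s"
  shows "0 \<le> (\<Prod>x\<in>#\<beta>. h x) \<and> (\<Prod>x\<in>#\<beta>. h x) \<le> s ^ size \<beta>"
  using assms
proof (induct \<beta>)
  case (add y \<beta>)
  then have "0 \<le> (\<Prod>x\<in>#\<beta>. h x)" "(\<Prod>x\<in>#\<beta>. h x) \<le> s ^ size \<beta>" "0 \<le> h y" "h y \<le> s" by auto
  then show ?case by (auto intro!: mult_mono)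
qed simp

section \<open>Lyapunov functions\<close>

lemma tendsto_zero_if_suminf_finite:
  fixes f :: "nat \<Rightarrow> ennreal"
  assumes "(\<Sum>n. f n) < \<infinity>"
  shows "f \<longlonglongrightarrow> 0"
proof -
  have f: "f n = ennreal (enn2real (f n))" for n
    using ennreal_suminf_lessD[OF assms, of n] by simp
  have "(\<Sum>n. ennreal (enn2real (f n))) \<noteq> top"
    using assms f by (metis infinity_ennreal_def less_irrefl suminf_cong)
  then have "summable (\<lambda>n. enn2real (f n))" by (intro summable_suminf_not_top) auto
  then have "(\<lambda>n. ennreal (enn2real (f n))) \<longlonglongrightarrow> ennreal 0"
    by (intro tendsto_ennrealI summable_LIMSEQ_zero)
  then show ?thesis using f by simp
qed

text \<open>
  The one-sided limit order book chain in the regime \<open>p > 1 / 2\<close>, where the size of the book drifts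
  upwards.
\<close>

locale lob_chain = N: prob_space N + M: prob_space M
  for p :: real and N :: "'v measure" and X :: "'v \<Rightarrow> real"
    and M :: "'w measure" and B :: "nat \<Rightarrow> 'w \<Rightarrow> book" +
  assumes p_le: "p \<le> 1" and p_gt: "1/2 < p"
    and X_meas [measurable]: "X \<in> borel_measurable N"
    and chain: "one_sided_lob_chain p N X M B"
begin

abbreviation "F \<equiv> natural_filtration M B"

lemma B_meas [measurable]: "B n \<in> measurable M book_algebra"
  using chain by (simp add: one_sided_lob_chain_def)

lemma space_F [simp]: "space (F n) = space M"
  by (simp add: natural_filtration_def space_measure_of_conv)

lemma subalgebra_F: "subalgebra M (F n)"
  unfolding subalgebra_def natural_filtration_def
  by (auto simp: space_measure_of_conv sets_measure_of_conv intro!: sets.sigma_sets_subset)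

lemma sets_F_mono: "sets (F n) \<subseteq> sets (F (Suc n))"
  unfolding natural_filtration_def
  by (auto simp: space_measure_of_conv sets_measure_of_conv intro!: sigma_sets_mono' intro: le_SucI)

lemma B_meas_F: 
  assumes "i \<le> n"
  shows "B i \<in> measurable (F n) book_algebra"
proof (rule measurableI)
  fix S assume "S \<in> sets book_algebra"
  then show "B i -` S \<inter> space (F n) \<in> sets (F n)"
    using assms unfolding natural_filtration_def
    by (auto simp: space_measure_of_conv sets_measure_of_conv intro!: sigma_sets.Basic)
qed simp

text \<open>
  The drift inequality integrated against a nonnegative weight \<open>w\<close> that is known at time \<open>n\<close>. The
  inequality is additive because the terms may be infinite.
\<close>

lemma lyapunov_step:
  fixes V g :: "book \<Rightarrow> ennreal"
  assumes V [measurable]: "V \<in> borel_measurable book_algebra" and fin: "\<And>\<beta>. V \<beta> < \<infinity>"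
    and g [measurable]: "g \<in> borel_measurable book_algebra"
    and drift: "\<And>\<beta>. lob_transition p N X V \<beta> + g \<beta> \<le> V \<beta>"
    and w [measurable]: "w \<in> borel_measurable (F n)"
  shows "(\<integral>\<^sup>+\<omega>. w \<omega> * V (B (Suc n) \<omega>) \<partial>M) + (\<integral>\<^sup>+\<omega>. w \<omega> * g (B n \<omega>) \<partial>M)
    \<le> (\<integral>\<^sup>+\<omega>. w \<omega> * V (B n \<omega>) \<partial>M)"
proof -
  interpret sigma_finite_subalgebra M "F n"
    by (intro finite_measure_subalgebra_is_sigma_finite finite_measure_subalgebra.intro
        finite_measure_subalgebra_axioms.intro subalgebra_F M.finite_measure_axioms)
  let ?C = "nn_cond_exp M (F n) (\<lambda>\<omega>'. V (B (Suc n) \<omega>'))"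
  have wM [measurable]: "w \<in> borel_measurable M"
    using measurable_from_subalg[OF subalgebra_F w] .
  have C: "AE \<omega> in M. ?C \<omega> = lob_transition p N X V (B n \<omega>)"
    using chain fin V unfolding one_sided_lob_chain_def by blast
  have "(\<integral>\<^sup>+\<omega>. w \<omega> * V (B (Suc n) \<omega>) \<partial>M) = (\<integral>\<^sup>+\<omega>. w \<omega> * ?C \<omega> \<partial>M)"
    by (rule nn_cond_exp_intg[symmetric]) auto
  then have "(\<integral>\<^sup>+\<omega>. w \<omega> * V (B (Suc n) \<omega>) \<partial>M) + (\<integral>\<^sup>+\<omega>. w \<omega> * g (B n \<omega>) \<partial>M)
      = (\<integral>\<^sup>+\<omega>. w \<omega> * ?C \<omega> + w \<omega> * g (B n \<omega>) \<partial>M)"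
    by (simp add: nn_integral_add)
  also have "\<dots> \<le> (\<integral>\<^sup>+\<omega>. w \<omega> * V (B n \<omega>) \<partial>M)"
  proof (rule nn_integral_mono_AE)
    show "AE \<omega> in M. w \<omega> * ?C \<omega> + w \<omega> * g (B n \<omega>) \<le> w \<omega> * V (B n \<omega>)"
      using C
    proof eventually_elim
      case (elim \<omega>)
      then show ?case
        using drift[of "B n \<omega>"] by (simp add: distrib_left[symmetric] mult_left_mono)
    qed
  qed
  finally show ?thesis .
qed

text \<open>
  The law of the initial book is arbitrary, so \<open>V (B 0)\<close> need not be integrable. Weighting all
  expectations by \<open>1 / (1 + V (B 0))\<close>, which is positive and known at time 0, repairs this.
\<close>

lemma lyapunov_summable:
  fixes V g :: "book \<Rightarrow> ennreal"
  assumes V [measurable]: "V \<in> borel_measurable book_algebra" and fin: "\<And>\<beta>. V \<beta> < \<infinity>"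
    and g [measurable]: "g \<in> borel_measurable book_algebra"
    and drift: "\<And>\<beta>. lob_transition p N X V \<beta> + g \<beta> \<le> V \<beta>"
  shows "AE \<omega> in M. (\<Sum>n. g (B n \<omega>)) < \<infinity>"
proof -
  define w where "w \<omega> = inverse (1 + V (B 0 \<omega>))" for \<omega>
  have [measurable]: "w \<in> borel_measurable (F n)" for n
  proof -
    have [measurable]: "B 0 \<in> measurable (F n) book_algebra" by (rule B_meas_F) simp
    show ?thesis unfolding w_def by measurable
  qed
  have [measurable]: "w \<in> borel_measurable M" unfolding w_def by measurable
  have "(\<integral>\<^sup>+\<omega>. w \<omega> * V (B n \<omega>) \<partial>M) + (\<Sum>i<n. \<integral>\<^sup>+\<omega>. w \<omega> * g (B i \<omega>) \<partial>M)
      \<le> (\<integral>\<^sup>+\<omega>. w \<omega> * V (B 0 \<omega>) \<partial>M)" for n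
  proof (induct n)
    case (Suc n)
    have "(\<integral>\<^sup>+\<omega>. w \<omega> * V (B (Suc n) \<omega>) \<partial>M) + (\<integral>\<^sup>+\<omega>. w \<omega> * g (B n \<omega>) \<partial>M)
      \<le> (\<integral>\<^sup>+\<omega>. w \<omega> * V (B n \<omega>) \<partial>M)"
      by (rule lyapunov_step[OF V fin g drift]) measurable
    from order_trans[OF add_right_mono[OF this] Suc] show ?case
      by (simp add: ac_simps)
  qed simp
  note le_init = this
  have init: "(\<integral>\<^sup>+\<omega>. w \<omega> * V (B 0 \<omega>) \<partial>M) \<le> (\<integral>\<^sup>+\<omega>. 1 \<partial>M)"
  proof (rule nn_integral_mono)
    fix \<omega>
    show "w \<omega> * V (B 0 \<omega>) \<le> 1"
      using fin[of "B 0 \<omega>"] unfolding w_def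
      by (cases "V (B 0 \<omega>)") 
        (auto simp: ennreal_1[symmetric] ennreal_plus[symmetric] inverse_ennreal ennreal_mult[symmetric] field_simps
          simp del: ennreal_1 ennreal_plus)
  qed
  have "(\<Sum>i<n. \<integral>\<^sup>+\<omega>. w \<omega> * g (B i \<omega>) \<partial>M) \<le> 1" for n
  proof -
    have "(\<Sum>i<n. \<integral>\<^sup>+\<omega>. w \<omega> * g (B i \<omega>) \<partial>M)
        \<le> (\<integral>\<^sup>+\<omega>. w \<omega> * V (B n \<omega>) \<partial>M) + (\<Sum>i<n. \<integral>\<^sup>+\<omega>. w \<omega> * g (B i \<omega>) \<partial>M)"
      by simp
    also have "\<dots> \<le> (\<integral>\<^sup>+\<omega>. 1 \<partial>M)" by (rule order_trans[OF le_init init])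
    finally show ?thesis by (simp add: M.emeasure_space_1)
  qed
  then have "(\<Sum>i. \<integral>\<^sup>+\<omega>. w \<omega> * g (B i \<omega>) \<partial>M) \<le> 1"
    by (intro suminf_le_const) auto
  then have "(\<integral>\<^sup>+\<omega>. w \<omega> * (\<Sum>i. g (B i \<omega>)) \<partial>M) \<le> 1"
    by (simp add: nn_integral_suminf[symmetric])
  then have "AE \<omega> in M. w \<omega> * (\<Sum>i. g (B i \<omega>)) \<noteq> \<infinity>"
    by (intro nn_integral_noteq_infinite) (auto simp: top_unique)
  then show ?thesis
  proof eventually_elim
    case (elim \<omega>)
    have "w \<omega> \<noteq> 0" using fin[of "B 0 \<omega>"] by (auto simp: w_def less_top)
    then show ?case using elim by (auto simp: ennreal_mult_eq_top_iff less_top)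
  qed
qed

lemma lyapunov_finitely_often:
  fixes V :: "book \<Rightarrow> ennreal"
  assumes V: "V \<in> borel_measurable book_algebra" and fin: "\<And>\<beta>. V \<beta> < \<infinity>"
    and S [measurable]: "S \<in> sets book_algebra" and c: "c > 0"
    and drift: "\<And>\<beta>. lob_transition p N X V \<beta> + ennreal c * indicator S \<beta> \<le> V \<beta>"
  shows "AE \<omega> in M. eventually (\<lambda>n. B n \<omega> \<notin> S) sequentially"
proof -
  have "AE \<omega> in M. (\<Sum>n. ennreal c * indicator S (B n \<omega>)) < \<infinity>"
    by (rule lyapunov_summable[OF V fin _ drift]) measurable
  then show ?thesis
  proof eventually_elim
    case (elim \<omega>)
    have "(\<lambda>n. ennreal c * indicator S (B n \<omega>)) \<longlonglongrightarrow> 0"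
      by (rule tendsto_zero_if_suminf_finite[OF elim])
    then have "eventually (\<lambda>n. ennreal c * indicator S (B n \<omega>) < ennreal c) sequentially"
      by (rule order_tendstoD) (use c in simp)
    then show ?case by eventually_elim (auto simp: indicator_def)
  qed
qed

text \<open>
  Ville's inequality for the nonnegative supermartingale \<open>V (B n)\<close>. The proof handles a finite
  horizon by backward recursion: on the event \<open>A'\<close> that the current book is outside \<open>S\<close>, one step of
  the chain is taken; elsewhere \<open>V\<close> is already at least 1.
\<close>

lemma maximal_inequality:
  fixes V :: "book \<Rightarrow> ennreal"
  assumes V [measurable]: "V \<in> borel_measurable book_algebra" and fin: "\<And>\<beta>. V \<beta> < \<infinity>"
    and drift: "\<And>\<beta>. lob_transition p N X V \<beta> \<le> V \<beta>"
    and S [measurable]: "S \<in> sets book_algebra" and VS: "\<And>\<beta>. \<beta> \<in> S \<Longrightarrow> 1 \<le> V \<beta>"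
  shows "emeasure M {\<omega> \<in> space M. \<exists>m\<ge>n. B m \<omega> \<in> S} \<le> (\<integral>\<^sup>+\<omega>. V (B n \<omega>) \<partial>M)"
proof -
  define E where "E n k = {\<omega> \<in> space M. \<exists>m\<in>{n..n+k}. B m \<omega> \<in> S}" for n k
  have E_meas [measurable]: "E n k \<in> sets M" for n k unfolding E_def by measurable
  have horizon: "emeasure M (A \<inter> E n k) \<le> (\<integral>\<^sup>+\<omega>. indicator A \<omega> * V (B n \<omega>) \<partial>M)"
    if "A \<in> sets (F n)" for A n k
    using that
  proof (induct k arbitrary: A n)
    case (0 A n)
    have A [measurable]: "A \<in> sets M" using 0 subalgebra_F unfolding subalgebra_def by blast
    have "emeasure M (A \<inter> E n 0) = (\<integral>\<^sup>+\<omega>. indicator (A \<inter> E n 0) \<omega> \<partial>M)" by simp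
    also have "\<dots> \<le> (\<integral>\<^sup>+\<omega>. indicator A \<omega> * V (B n \<omega>) \<partial>M)"
      by (rule nn_integral_mono) (auto simp: E_def indicator_def VS)
    finally show ?case .
  next
    case (Suc k A n)
    have A [measurable]: "A \<in> sets M" using Suc subalgebra_F unfolding subalgebra_def by blast
    define A' where "A' = A \<inter> (B n -` (- S) \<inter> space (F n))"
    have A'F: "A' \<in> sets (F n)"
      unfolding A'_def using Suc(2) B_meas_F[of n n] S
      by (intro sets.Int measurable_sets[of _ _ book_algebra]) (auto simp: sets.compl_sets[of S book_algebra, simplified] Compl_eq_Diff_UNIV)
    have A'F2: "A' \<in> sets (F (Suc n))" using A'F sets_F_mono by blast
    have A'M [measurable]: "A' \<in> sets M" using A'F subalgebra_F unfolding subalgebra_def by blast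
    have "emeasure M (A \<inter> E n (Suc k)) \<le> emeasure M ((A - A') \<union> (A' \<inter> E (Suc n) k))"
    proof (rule emeasure_mono)
      have "\<omega> \<in> E (Suc n) k" if "\<omega> \<in> E n (Suc k)" "B n \<omega> \<notin> S" for \<omega>
      proof -
        obtain m where m: "m \<in> {n..n + Suc k}" "B m \<omega> \<in> S" using \<open>\<omega> \<in> E n (Suc k)\<close> by (auto simp: E_def)
        then have "m \<in> {Suc n..Suc n + k}" using that(2) by (cases "m = n") auto
        then show ?thesis using m that(1) by (auto simp: E_def)
      qed
      then show "A \<inter> E n (Suc k) \<subseteq> (A - A') \<union> (A' \<inter> E (Suc n) k)"
        by (auto simp: A'_def E_def)
    qed measurable
    also have "\<dots> \<le> emeasure M (A - A') + emeasure M (A' \<inter> E (Suc n) k)"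
      by (rule emeasure_subadditive) measurable
    also have "\<dots> \<le> (\<integral>\<^sup>+\<omega>. indicator (A - A') \<omega> * V (B n \<omega>) \<partial>M) + (\<integral>\<^sup>+\<omega>. indicator A' \<omega> * V (B n \<omega>) \<partial>M)"
    proof (rule add_mono)
      have "emeasure M (A - A') = (\<integral>\<^sup>+\<omega>. indicator (A - A') \<omega> \<partial>M)" by simp
      also have "\<dots> \<le> (\<integral>\<^sup>+\<omega>. indicator (A - A') \<omega> * V (B n \<omega>) \<partial>M)"
        by (rule nn_integral_mono) (auto simp: A'_def indicator_def VS)
      finally show "emeasure M (A - A') \<le> \<dots>" .
      have "emeasure M (A' \<inter> E (Suc n) k) \<le> (\<integral>\<^sup>+\<omega>. indicator A' \<omega> * V (B (Suc n) \<omega>) \<partial>M)"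
        by (rule Suc(1)[OF A'F2])
      also have "\<dots> \<le> (\<integral>\<^sup>+\<omega>. indicator A' \<omega> * V (B n \<omega>) \<partial>M)"
        using lyapunov_step[OF V fin, of "\<lambda>_. 0" "indicator A'" n] drift A'F by simp
      finally show "emeasure M (A' \<inter> E (Suc n) k) \<le> \<dots>" .
    qed
    also have "\<dots> = (\<integral>\<^sup>+\<omega>. indicator (A - A') \<omega> * V (B n \<omega>) + indicator A' \<omega> * V (B n \<omega>) \<partial>M)"
      by (rule nn_integral_add[symmetric]) measurable
    also have "\<dots> = (\<integral>\<^sup>+\<omega>. indicator A \<omega> * V (B n \<omega>) \<partial>M)"
      by (rule nn_integral_cong) (auto simp: A'_def indicator_def)
    finally show ?case .
  qed
  have "{\<omega> \<in> space M. \<exists>m\<ge>n. B m \<omega> \<in> S} = (\<Union>k. E n k)"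
  proof (intro set_eqI iffI)
    fix \<omega> assume "\<omega> \<in> {\<omega> \<in> space M. \<exists>m\<ge>n. B m \<omega> \<in> S}"
    then obtain m where "\<omega> \<in> space M" "m \<ge> n" "B m \<omega> \<in> S" by blast
    then have "\<omega> \<in> E n (m - n)" by (auto simp: E_def intro!: bexI[of _ m])
    then show "\<omega> \<in> (\<Union>k. E n k)" by blast
  qed (auto simp: E_def)
  moreover have "emeasure M (\<Union>k. E n k) = (SUP k. emeasure M (E n k))"
    by (rule SUP_emeasure_incseq[symmetric]) (auto simp: E_def incseq_def)
  moreover have "emeasure M (E n k) \<le> (\<integral>\<^sup>+\<omega>. V (B n \<omega>) \<partial>M)" for k
  proof -
    have "space M \<inter> E n k = E n k" by (auto simp: E_def)
    moreover have "(\<integral>\<^sup>+\<omega>. indicator (space M) \<omega> * V (B n \<omega>) \<partial>M) = (\<integral>\<^sup>+\<omega>. V (B n \<omega>) \<partial>M)"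
      by (rule nn_integral_cong) simp
    ultimately show ?thesis using horizon[of "space M" n k] sets.top[of "F n"] by simp
  qed
  ultimately show ?thesis by (simp add: SUP_le_iff)
qed

end

section \<open>The growth of the book\<close>

context lob_chain
begin

lemma p_nonneg: "0 \<le> p" using p_gt by simp

text \<open>
  A multiplicative function of the book gains the factor \<open>h (price + X)\<close> or loses the factor
  \<open>h price\<close>, so all points except the one at the price enter through a common factor.
\<close>

lemma lob_transition_prod:
  fixes h :: "real \<Rightarrow> real"
  assumes [measurable]: "h \<in> borel_measurable borel" and h: "\<And>x. 0 < h x" "\<And>x. h x \<le> 1"
    and \<beta>: "\<beta> \<noteq> {#}"
  shows "lob_transition p N X (\<lambda>\<beta>. ennreal (\<Prod>x\<in>#\<beta>. h x)) \<beta> =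
    ennreal ((\<Prod>x\<in>#\<beta> - {#price \<beta>#}. h x) *
      (p * h (price \<beta>) * (\<integral>v. h (price \<beta> + X v) \<partial>N) + (1 - p)))"
proof -
  define \<beta>' where "\<beta>' = \<beta> - {#price \<beta>#}"
  define Q where "Q = (\<Prod>x\<in>#\<beta>'. h x)"
  have eq: "\<beta> = add_mset (price \<beta>) \<beta>'" using price_in_book[OF \<beta>] by (simp add: \<beta>'_def)
  have prod: "(\<Prod>x\<in>#\<beta>. h x) = h (price \<beta>) * Q" by (subst eq) (simp add: Q_def)
  have Q: "0 \<le> Q" using prod_over_book_bounds[of \<beta>' h 1] h by (force simp: Q_def less_imp_le)
  have int: "integrable N (\<lambda>v. h (price \<beta> + X v))"
    by (rule N.integrable_const_bound[of _ 1]) (use h in \<open>auto simp: abs_of_pos\<close>)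
  have pos: "0 \<le> (\<integral>v. h (price \<beta> + X v) \<partial>N)" by (simp add: h less_imp_le)
  have "(\<integral>\<^sup>+ v. ennreal (\<Prod>x\<in>#\<beta> + {#price \<beta> + X v#}. h x) \<partial>N)
      = (\<integral>\<^sup>+ v. ennreal (h (price \<beta>) * Q) * ennreal (h (price \<beta> + X v)) \<partial>N)"
    using h Q by (intro nn_integral_cong) (simp add: prod ennreal_mult[symmetric] mult.commute less_imp_le)
  also have "\<dots> = ennreal (h (price \<beta>) * Q) * (\<integral>\<^sup>+ v. ennreal (h (price \<beta> + X v)) \<partial>N)"
    by (rule nn_integral_cmult) measurable
  also have "(\<integral>\<^sup>+ v. ennreal (h (price \<beta> + X v)) \<partial>N) = ennreal (\<integral>v. h (price \<beta> + X v) \<partial>N)"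
    using int h by (intro nn_integral_eq_integral) (auto simp: less_imp_le)
  finally have "lob_transition p N X (\<lambda>\<beta>. ennreal (\<Prod>x\<in>#\<beta>. h x)) \<beta> =
      ennreal (p * (h (price \<beta>) * Q * (\<integral>v. h (price \<beta> + X v) \<partial>N)) + (1 - p) * Q)"
    using \<beta> Q pos h[of "price \<beta>"] p_le p_nonneg
    by (simp add: lob_transition_def \<beta>'_def[symmetric] Q_def[symmetric] ennreal_mult[symmetric]
        ennreal_plus[symmetric] del: ennreal_plus)
  then show ?thesis by (simp add: \<beta>'_def[symmetric] Q_def[symmetric] algebra_simps)
qed

text \<open>
  For \<open>s < 1\<close> the factor \<open>(p s\<^sup>2 + 1 - p) / s\<close> for a non-empty book is below 1 exactly when
  \<open>s\<close> exceeds \<open>(1 - p) / p\<close>. For the empty book the function drops from \<open>1\<close> to \<open>s\<close>.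
\<close>

lemma lob_transition_size_power:
  assumes s: "1 - p < p * s" "s < 1"
  obtains \<kappa> where "0 < \<kappa>" "\<kappa> < 1"
    "\<And>\<beta>. lob_transition p N X (\<lambda>\<beta>. ennreal (s ^ size \<beta>)) \<beta>
       + ennreal ((1 - \<kappa>) * s ^ size \<beta>) \<le> ennreal (s ^ size \<beta>)"
proof -
  have s0: "0 < s" using s p_le p_gt by (intro zero_less_mult_pos[of p s]) auto
  define \<kappa> where "\<kappa> = max s ((p * s * s + (1 - p)) / s)"
  \<comment> \<open>the roots of \<open>p s\<^sup>2 - s + (1 - p)\<close> are \<open>1\<close> and \<open>(1 - p) / p\<close>\<close>
  have "(s - 1) * (p * s - (1 - p)) < 0" using s by (intro mult_neg_pos) auto
  then have "p * s * s + (1 - p) < s" by (simp add: algebra_simps)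
  then have \<kappa>: "0 < \<kappa>" "\<kappa> < 1" using s0 s by (auto simp: \<kappa>_def)
  have le: "p * s * s + (1 - p) \<le> \<kappa> * s"
    using s0 by (simp add: \<kappa>_def max_def field_simps)
  show ?thesis
  proof (rule that[OF \<kappa>])
    fix \<beta>
    show "lob_transition p N X (\<lambda>\<beta>. ennreal (s ^ size \<beta>)) \<beta>
       + ennreal ((1 - \<kappa>) * s ^ size \<beta>) \<le> ennreal (s ^ size \<beta>)"
    proof (cases "\<beta> = {#}")
      case True
      have "s + (1 - \<kappa>) \<le> 1" by (simp add: \<kappa>_def)
      then have "ennreal (s + (1 - \<kappa>)) \<le> ennreal 1" by (rule ennreal_leI)
      then show ?thesis using True s0 \<kappa> by (simp add: lob_transition_def)
    next
      case False
      define m where "m = size (\<beta> - {#price \<beta>#})"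
      have m: "size \<beta> = Suc m"
        using price_in_book[OF False] False
        by (simp add: m_def size_Diff_singleton) (metis Suc_pred nonempty_has_size)
      have "s ^ m * (p * s * s + (1 - p)) \<le> s ^ m * (\<kappa> * s)"
        using le s0 by (intro mult_left_mono) auto
      then have "s ^ m * (p * s * s + (1 - p)) + (1 - \<kappa>) * s ^ size \<beta> \<le> s ^ size \<beta>"
        by (simp add: m algebra_simps)
      moreover have "lob_transition p N X (\<lambda>\<beta>. ennreal (s ^ size \<beta>)) \<beta> = ennreal (s ^ m * (p * s * s + (1 - p)))"
        using lob_transition_prod[of "\<lambda>_. s" \<beta>] s0 s False by (simp add: m_def N.prob_space)
      ultimately show ?thesis
        using s0 \<kappa> p_nonneg p_le
        by (simp add: ennreal_plus[symmetric] ennreal_leI del: ennreal_plus)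
    qed
  qed
qed

lemma expectation_size_power:
  assumes s: "1 - p < p * s" "s < 1"
  obtains \<kappa> where "0 < \<kappa>" "\<kappa> < 1"
    "\<And>n. (\<integral>\<^sup>+\<omega>. ennreal (s ^ size (B n \<omega>)) \<partial>M) \<le> ennreal (\<kappa> ^ n)"
proof -
  obtain \<kappa> where \<kappa>: "0 < \<kappa>" "\<kappa> < 1" and
    drift: "\<And>\<beta>. lob_transition p N X (\<lambda>\<beta>. ennreal (s ^ size \<beta>)) \<beta>
       + ennreal ((1 - \<kappa>) * s ^ size \<beta>) \<le> ennreal (s ^ size \<beta>)"
    using lob_transition_size_power[OF s] by blast
  have s0: "0 < s" using s p_le p_gt by (intro zero_less_mult_pos[of p s]) auto
  have [measurable]: "(\<lambda>\<beta>::book. ennreal (c * s ^ size \<beta>)) \<in> borel_measurable book_algebra" for c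
    by (rule measurable_compose[OF measurable_size_book]) simp
  define I where "I n = (\<integral>\<^sup>+\<omega>. ennreal (s ^ size (B n \<omega>)) \<partial>M)" for n
  have [measurable]: "(\<lambda>\<beta>::book. ennreal (s ^ size \<beta>)) \<in> borel_measurable book_algebra"
    by (rule measurable_compose[OF measurable_size_book]) simp
  have I1: "I n \<le> 1" for n
  proof -
    have "I n \<le> (\<integral>\<^sup>+\<omega>. 1 \<partial>M)" unfolding I_def
      by (rule nn_integral_mono) (use s0 s in \<open>auto simp: power_le_one ennreal_le_1\<close>)
    then show ?thesis by (simp add: M.emeasure_space_1)
  qed
  have "I (Suc n) \<le> ennreal \<kappa> * I n" for n
  proof -
    have "I (Suc n) + (\<integral>\<^sup>+\<omega>. ennreal ((1 - \<kappa>) * s ^ size (B n \<omega>)) \<partial>M) \<le> I n"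
      using lyapunov_step[of "\<lambda>\<beta>. ennreal (s ^ size \<beta>)" "\<lambda>\<beta>. ennreal ((1 - \<kappa>) * s ^ size \<beta>)" "\<lambda>_. 1" n] drift
      by (simp add: I_def)
    also have "(\<integral>\<^sup>+\<omega>. ennreal ((1 - \<kappa>) * s ^ size (B n \<omega>)) \<partial>M) = ennreal (1 - \<kappa>) * I n"
      using \<kappa> s0 unfolding I_def by (subst nn_integral_cmult[symmetric]) (simp_all add: ennreal_mult)
    also have "I n = ennreal (1 - \<kappa>) * I n + ennreal \<kappa> * I n"
    proof -
      have "ennreal (1 - \<kappa>) * I n + ennreal \<kappa> * I n = ennreal (1 - \<kappa> + \<kappa>) * I n"
        using \<kappa> by (subst ennreal_plus) (auto simp: distrib_right)
      then show ?thesis by simp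
    qed
    finally have "ennreal (1 - \<kappa>) * I n + I (Suc n) \<le> ennreal (1 - \<kappa>) * I n + ennreal \<kappa> * I n"
      by (simp add: add.commute)
    moreover have "ennreal (1 - \<kappa>) * I n \<noteq> \<top>"
      using I1[of n] by (auto simp: ennreal_mult_eq_top_iff top_unique)
    ultimately show ?thesis by (simp add: ennreal_add_left_cancel_le)
  qed
  note step = this
  have "I n \<le> ennreal (\<kappa> ^ n)" for n
  proof (induct n)
    case 0
    then show ?case using I1[of 0] by simp
  next
    case (Suc n)
    have "I (Suc n) \<le> ennreal \<kappa> * I n" by (rule step)
    also have "\<dots> \<le> ennreal \<kappa> * ennreal (\<kappa> ^ n)" by (rule mult_left_mono[OF Suc]) simp
    finally show ?case using \<kappa> by (simp add: ennreal_mult)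
  qed
  then show ?thesis using that[OF \<kappa>] by (simp add: I_def)
qed

lemma eventually_nonempty: "AE \<omega> in M. eventually (\<lambda>n. B n \<omega> \<noteq> {#}) sequentially"
proof -
  \<comment> \<open>any \<open>s < 1\<close> with \<open>p s > 1 - p\<close> would do; here \<open>p s = 1 / 2\<close>\<close>
  define s where "s = 1 / (2 * p)"
  have s: "1 - p < p * s" "s < 1" using p_gt by (auto simp: s_def)
  obtain \<kappa> where \<kappa>: "0 < \<kappa>" "\<kappa> < 1" and
    drift: "\<And>\<beta>. lob_transition p N X (\<lambda>\<beta>. ennreal (s ^ size \<beta>)) \<beta>
       + ennreal ((1 - \<kappa>) * s ^ size \<beta>) \<le> ennreal (s ^ size \<beta>)"
    using lob_transition_size_power[OF s] by blast
  have "AE \<omega> in M. eventually (\<lambda>n. B n \<omega> \<notin> {{#}}) sequentially"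
  proof (rule lyapunov_finitely_often[of "\<lambda>\<beta>. ennreal (s ^ size \<beta>)" _ "1 - \<kappa>"])
    show "(\<lambda>\<beta>::book. ennreal (s ^ size \<beta>)) \<in> borel_measurable book_algebra"
      by (rule measurable_compose[OF measurable_size_book]) simp
    have "{{#}} = {\<beta>. book_mass \<beta> UNIV = 0}" by (auto simp: book_mass_UNIV)
    then show "{{#}} \<in> sets book_algebra" using sets_book_mass[of UNIV 0] by simp
    fix \<beta> :: book
    have "ennreal (1 - \<kappa>) * indicator {{#}} \<beta> \<le> ennreal ((1 - \<kappa>) * s ^ size \<beta>)"
      by (auto simp: indicator_def)
    then show "lob_transition p N X (\<lambda>\<beta>. ennreal (s ^ size \<beta>)) \<beta> + ennreal (1 - \<kappa>) * indicator {{#}} \<beta>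
        \<le> ennreal (s ^ size \<beta>)"
      using drift[of \<beta>] by (meson add_left_mono order_trans)
  qed (use \<kappa> in auto)
  then show ?thesis by simp
qed

end

section \<open>Convergence of the price to minus infinity\<close>

context lob_chain
begin

text \<open>
  The Lyapunov function is \<open>E = (\<Sum>x\<in>#\<beta>. exp (\<theta> x))\<close> plus a multiple \<open>K\<close> of \<open>G = s ^ size \<beta>\<close>.
  From the empty book \<open>E\<close> jumps from 0 to 1; the multiple is chosen so that the decrease of \<open>K G\<close>
  pays for this.
\<close>

lemma price_at_bot:
  assumes \<theta>: "0 < \<theta>" and int: "integrable N (\<lambda>v. exp (\<theta> * X v))"
    and small: "p * (\<integral>v. exp (\<theta> * X v) \<partial>N) < 1 - p"
  shows "AE \<omega> in M. filterlim (\<lambda>n. price (B n \<omega>)) at_bot sequentially"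
proof -
  define \<phi> where "\<phi> = (\<integral>v. exp (\<theta> * X v) \<partial>N)"
  define c where "c = 1 - p - p * \<phi>"
  have c: "0 < c" using small by (simp add: c_def \<phi>_def)
  have \<phi>0: "0 \<le> \<phi>" by (simp add: \<phi>_def)
  define s where "s = 1 / (2 * p)"
  have s: "1 - p < p * s" "s < 1" using p_gt by (auto simp: s_def)
  obtain \<kappa> where \<kappa>: "0 < \<kappa>" "\<kappa> < 1" and
    drift: "\<And>\<beta>. lob_transition p N X (\<lambda>\<beta>. ennreal (s ^ size \<beta>)) \<beta>
       + ennreal ((1 - \<kappa>) * s ^ size \<beta>) \<le> ennreal (s ^ size \<beta>)"
    using lob_transition_size_power[OF s] by blast
  define E where "E \<beta> = (\<Sum>x\<in>#\<beta>. ennreal (exp (\<theta> * x)))" for \<beta>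
  define G where "G \<beta> = ennreal (s ^ size \<beta>)" for \<beta> :: book
  define K where "K = ennreal (1 / (1 - \<kappa>))"
  define g where "g \<beta> = (if \<beta> = {#} then 0 else ennreal (c * exp (\<theta> * price \<beta>)))" for \<beta>
  have [measurable]: "E \<in> borel_measurable book_algebra"
    unfolding E_def by (rule measurable_sum_over_book) measurable
  have [measurable]: "G \<in> borel_measurable book_algebra"
    unfolding G_def by (rule measurable_compose[OF measurable_size_book]) simp
  have e[measurable]: "Measurable.pred book_algebra (\<lambda>\<beta>. \<beta> = {#})"
  proof -
    have "Measurable.pred book_algebra (\<lambda>\<beta>. size \<beta> = 0)" by measurable
    then show ?thesis by simp
  qed
  have [measurable]: "g \<in> borel_measurable book_algebra" unfolding g_def by measurable
  have Eadd: "E (add_mset y \<beta>) = ennreal (exp (\<theta> * y)) + E \<beta>" for y \<beta> by (simp add: E_def)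
  have Efin: "E \<beta> < \<infinity>" for \<beta> by (induct \<beta>) (auto simp: E_def)
  have add: "lob_transition p N X (\<lambda>\<beta>. E \<beta> + K * G \<beta>) \<beta>
      = lob_transition p N X E \<beta> + K * lob_transition p N X G \<beta>" for \<beta>
  proof -
    have a: "(\<lambda>y. E (\<beta> + {#y#})) \<in> borel_measurable borel" by (simp add: Eadd)
    have b: "(\<lambda>y. G (\<beta> + {#y#})) \<in> borel_measurable borel" by (simp add: G_def)
    have "(\<integral>\<^sup>+ v. E (\<beta> + {#price \<beta> + X v#}) + K * G (\<beta> + {#price \<beta> + X v#}) \<partial>N) =
        (\<integral>\<^sup>+ v. E (\<beta> + {#price \<beta> + X v#}) \<partial>N) + K * (\<integral>\<^sup>+ v. G (\<beta> + {#price \<beta> + X v#}) \<partial>N)"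
      using measurable_compose[OF _ a, of "\<lambda>v. price \<beta> + X v" N] measurable_compose[OF _ b, of "\<lambda>v. price \<beta> + X v" N]
      by (simp add: nn_integral_add nn_integral_cmult)
    then show ?thesis by (simp add: lob_transition_def algebra_simps)
  qed
  have driftE: "lob_transition p N X E \<beta> + g \<beta> \<le> E \<beta> + indicator {{#}} \<beta>" for \<beta>
  proof (cases "\<beta> = {#}")
    case True
    then show ?thesis by (simp add: lob_transition_def E_def g_def)
  next
    case False
    define \<beta>' where "\<beta>' = \<beta> - {#price \<beta>#}"
    define e where "e = exp (\<theta> * price \<beta>)"
    obtain Q where Q: "E \<beta>' = ennreal Q" "0 \<le> Q"
      using Efin[of \<beta>'] by (cases "E \<beta>'") auto
    have eq: "\<beta> = add_mset (price \<beta>) \<beta>'" using price_in_book[OF False] by (simp add: \<beta>'_def)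
    have E\<beta>: "E \<beta> = ennreal (e + Q)" 
      by (subst eq) (use Q in \<open>simp add: Eadd e_def\<close>)
    have e0: "0 < e" by (simp add: e_def)
    have "(\<integral>\<^sup>+ v. E (\<beta> + {#price \<beta> + X v#}) \<partial>N)
        = (\<integral>\<^sup>+ v. ennreal e * ennreal (exp (\<theta> * X v)) + ennreal (e + Q) \<partial>N)"
      by (intro nn_integral_cong)
        (simp add: Eadd E\<beta> e_def ennreal_mult[symmetric] exp_add distrib_left)
    also have "\<dots> = ennreal e * (\<integral>\<^sup>+ v. ennreal (exp (\<theta> * X v)) \<partial>N) + ennreal (e + Q)"
      by (simp add: nn_integral_add nn_integral_cmult N.emeasure_space_1)
    also have "(\<integral>\<^sup>+ v. ennreal (exp (\<theta> * X v)) \<partial>N) = ennreal \<phi>"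
      unfolding \<phi>_def using int by (intro nn_integral_eq_integral) auto
    finally have "lob_transition p N X E \<beta> + g \<beta>
        = ennreal (p * (e * \<phi> + (e + Q)) + (1 - p) * Q + c * e)"
      using False Q e0 \<phi>0 p_nonneg p_le c
      by (simp add: lob_transition_def \<beta>'_def[symmetric] g_def e_def[symmetric] ennreal_mult[symmetric]
          ennreal_plus[symmetric] del: ennreal_plus)
    also have "p * (e * \<phi> + (e + Q)) + (1 - p) * Q + c * e = e + Q"
      by (simp add: c_def algebra_simps)
    finally show ?thesis using E\<beta> by simp
  qed
  have driftG: "K * lob_transition p N X G \<beta> + indicator {{#}} \<beta> \<le> K * G \<beta>" for \<beta>
  proof -
    have "indicator {{#}} \<beta> \<le> K * ennreal ((1 - \<kappa>) * s ^ size \<beta>)"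
      using \<kappa> by (auto simp: K_def indicator_def ennreal_mult[symmetric])
    then have "K * lob_transition p N X G \<beta> + indicator {{#}} \<beta>
        \<le> K * (lob_transition p N X G \<beta> + ennreal ((1 - \<kappa>) * s ^ size \<beta>))"
      by (simp add: distrib_left add_left_mono)
    also have "\<dots> \<le> K * G \<beta>"
      using drift[of \<beta>] unfolding G_def by (intro mult_left_mono) auto
    finally show ?thesis .
  qed
  have "AE \<omega> in M. (\<Sum>n. g (B n \<omega>)) < \<infinity>"
  proof (rule lyapunov_summable[of "\<lambda>\<beta>. E \<beta> + K * G \<beta>"])
    show "E \<beta> + K * G \<beta> < \<infinity>" for \<beta>
      using Efin[of \<beta>] by (simp add: K_def G_def ennreal_mult_less_top)
    show "lob_transition p N X (\<lambda>\<beta>. E \<beta> + K * G \<beta>) \<beta> + g \<beta> \<le> E \<beta> + K * G \<beta>" for \<beta>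
    proof -
      have "lob_transition p N X (\<lambda>\<beta>. E \<beta> + K * G \<beta>) \<beta> + g \<beta> 
          = (lob_transition p N X E \<beta> + g \<beta>) + K * lob_transition p N X G \<beta>"
        by (simp add: add ac_simps)
      also have "\<dots> \<le> (E \<beta> + indicator {{#}} \<beta>) + K * lob_transition p N X G \<beta>"
        by (rule add_right_mono[OF driftE])
      also have "\<dots> = E \<beta> + (K * lob_transition p N X G \<beta> + indicator {{#}} \<beta>)"
        by (simp add: ac_simps)
      also have "\<dots> \<le> E \<beta> + K * G \<beta>" by (rule add_left_mono[OF driftG])
      finally show ?thesis .
    qed
  qed measurable
  then show ?thesis using eventually_nonempty
  proof eventually_elim
    case (elim \<omega>)
    have lim: "(\<lambda>n. g (B n \<omega>)) \<longlonglongrightarrow> 0"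
      by (rule tendsto_zero_if_suminf_finite[OF elim(1)])
    show ?case
      unfolding filterlim_at_bot
    proof
      fix Z
      have "eventually (\<lambda>n. g (B n \<omega>) < ennreal (c * exp (\<theta> * Z))) sequentially"
        by (rule order_tendstoD[OF lim]) (use c in simp)
      with elim(2) show "eventually (\<lambda>n. price (B n \<omega>) \<le> Z) sequentially"
      proof eventually_elim
        case (elim n)
        then show ?case using c \<theta> by (auto simp: g_def ennreal_less_iff)
      qed
    qed
  qed
qed

end

section \<open>Convergence of the price to plus infinity\<close>

lemma (in prob_space) pos_prob_above:
  fixes X :: "'a \<Rightarrow> real"
  assumes [measurable]: "X \<in> borel_measurable M" and pos: "0 < measure M {v \<in> space M. 0 < X v}"
  obtains d where "0 < d" "0 < measure M {v \<in> space M. d < X v}"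
proof -
  have "(\<lambda>n. measure M {v \<in> space M. 1 / real (Suc n) < X v}) \<longlonglongrightarrow>
      measure M (\<Union>n. {v \<in> space M. 1 / real (Suc n) < X v})"
  proof (rule finite_Lim_measure_incseq)
    show "incseq (\<lambda>n. {v \<in> space M. 1 / real (Suc n) < X v})"
    proof (rule incseq_SucI, safe)
      fix n v assume "1 / real (Suc n) < X v"
      moreover have "1 / real (Suc (Suc n)) \<le> 1 / real (Suc n)" by (intro divide_left_mono) auto
      ultimately show "1 / real (Suc (Suc n)) < X v" by linarith
    qed
  qed auto
  also have "(\<Union>n. {v \<in> space M. 1 / real (Suc n) < X v}) = {v \<in> space M. 0 < X v}"
  proof safe
    fix n v assume "1 / real (Suc n) < X v"
    moreover have "0 < 1 / real (Suc n)" by simp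
    ultimately show "0 < X v" by linarith
  next
    fix v assume "v \<in> space M" "0 < X v"
    then show "v \<in> (\<Union>n. {v \<in> space M. 1 / real (Suc n) < X v})"
      using reals_Archimedean[of "X v"] by (auto simp: inverse_eq_divide)
  qed
  finally have "eventually (\<lambda>n. 0 < measure M {v \<in> space M. 1 / real (Suc n) < X v}) sequentially"
    using pos by (rule order_tendstoD)
  then obtain n where "0 < measure M {v \<in> space M. 1 / real (Suc n) < X v}"
    by (auto simp: eventually_sequentially)
  then show ?thesis by (intro that[of "1 / real (Suc n)"]) auto
qed

context lob_chain
begin

text \<open>
  Here \<open>u\<close> is a multiple of \<open>W\<close> so small that replacing the linear inequality
  \<open>\<nu> u(x) \<le> E u(x + X)\<close> by the quadratic one
  \<open>(1 - p) u(x) \<le> p (1 - u(x)) E u(x + X)\<close> is covered by the gap between \<open>p \<nu>\<close> and \<open>1 - p\<close>. The latter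
  says exactly that \<open>h = 1 - u\<close> satisfies \<open>p h(x) E h(x + X) + (1 - p) \<le> h(x)\<close>, the condition under
  which the product of \<open>h\<close> over the book is a supermartingale.
\<close>

lemma price_at_top:
  fixes W :: "real \<Rightarrow> real"
  assumes mono: "mono W" and zero: "\<And>x. x < 0 \<Longrightarrow> W x = 0" and pos: "\<And>x. 0 < x \<Longrightarrow> 0 < W x"
    and bound: "\<And>x. W x \<le> C" and \<nu>: "1 - p < p * \<nu>"
    and sub: "\<And>x. \<nu> * W x \<le> (\<integral>v. W (x + X v) \<partial>N)"
    and X_pos: "0 < measure N {v \<in> space N. 0 < X v}"
  shows "AE \<omega> in M. filterlim (\<lambda>n. price (B n \<omega>)) at_top sequentially"
proof -
  have W0: "0 \<le> W x" for x
    using zero[of x] pos[of x] zero[of "-1"] monoD[OF mono, of "-1" 0] by (cases x "0::real" rule: linorder_cases) auto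
  have [measurable]: "W \<in> borel_measurable borel" by (rule borel_measurable_mono[OF mono])
  have C: "0 < C" using pos[of 1] bound[of 1] by simp
  have \<nu>0: "0 < \<nu>" using \<nu> p_le p_gt by (intro zero_less_mult_pos[of p \<nu>]) auto
  define t where "t = min (1/2) (1 - (1 - p) / (p * \<nu>))"
  have t: "0 < t" "t < 1" "1 - p \<le> p * \<nu> * (1 - t)"
  proof -
    have "0 < p * \<nu>" using \<nu>0 p_gt by simp
    then have "(1 - p) / (p * \<nu>) < 1" using \<nu> by simp
    then show "0 < t" "t < 1" by (auto simp: t_def)
    have "(1 - p) / (p * \<nu>) \<le> 1 - t" by (auto simp: t_def)
    then show "1 - p \<le> p * \<nu> * (1 - t)" using \<open>0 < p * \<nu>\<close> by (simp add: divide_le_eq mult.commute)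
  qed
  define u where "u x = t / C * W x" for x
  have u0: "0 \<le> u x" for x using W0 t C by (simp add: u_def)
  have ut: "u x \<le> t" for x
    using mult_left_mono[OF bound[of x], of "t / C"] t C by (simp add: u_def)
  have umono: "u x \<le> u y" if "x \<le> y" for x y
    using monoD[OF mono that] t C unfolding u_def by (intro mult_left_mono) auto
  have uzero: "u x = 0" if "x < 0" for x using zero[OF that] by (simp add: u_def)
  have upos: "0 < u x" if "0 < x" for x using pos[OF that] t C by (simp add: u_def)
  have [measurable]: "u \<in> borel_measurable borel" unfolding u_def by measurable
  have uint: "integrable N (\<lambda>v. u (x + X v))" for x
    by (rule N.integrable_const_bound[of _ t]) (use u0 ut in auto)
  have usub: "\<nu> * u x \<le> (\<integral>v. u (x + X v) \<partial>N)" for x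
    using mult_left_mono[OF sub[of x], of "t / C"] t C by (simp add: u_def mult.left_commute)
  define U where "U x = (\<integral>v. u (x + X v) \<partial>N)" for x
  define h where "h L x = 1 - u (x - L)" for L x
  have h: "0 < h L x" "h L x \<le> 1" for L x using ut[of "x - L"] u0[of "x - L"] t by (auto simp: h_def)
  have [measurable]: "h L \<in> borel_measurable borel" for L unfolding h_def by measurable
  have hint: "(\<integral>v. h L (x + X v) \<partial>N) = 1 - U (x - L)" for L x
    using uint[of "x - L"] by (simp add: h_def U_def N.prob_space diff_add_eq)
  have hdrift: "p * h L x * (1 - U (x - L)) + (1 - p) \<le> h L x" for L x
  proof -
    define y where "y = x - L"
    have "(1 - p) * u y \<le> p * \<nu> * (1 - t) * u y" by (rule mult_right_mono[OF t(3) u0])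
    also have "\<dots> \<le> p * (1 - u y) * (\<nu> * u y)"
    proof -
      have "(p * \<nu> * u y) * (1 - t) \<le> (p * \<nu> * u y) * (1 - u y)"
        using ut[of y] u0[of y] \<nu>0 p_nonneg by (intro mult_left_mono) auto
      then show ?thesis by (simp add: ac_simps)
    qed
    also have "\<dots> \<le> p * (1 - u y) * U y"
      unfolding U_def using usub[of y] ut[of y] t p_nonneg by (intro mult_left_mono) auto
    finally have "(1 - p) * u y \<le> p * (1 - u y) * U y" .
    then show ?thesis by (simp add: h_def y_def[symmetric] algebra_simps)
  qed
  define V where "V L \<beta> = ennreal (\<Prod>x\<in>#\<beta>. h L x)" for L \<beta>
  have [measurable]: "V L \<in> borel_measurable book_algebra" for L
    unfolding V_def using h by (intro measurable_prod_over_book) auto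
  have Vfin: "V L \<beta> < \<infinity>" for L \<beta> by (simp add: V_def)
  have V_below: "V L \<beta> = 1" if "\<And>x. x \<in># \<beta> \<Longrightarrow> x < L" for L \<beta>
  proof -
    have "(\<Prod>x\<in>#\<beta>. h L x) = 1" using that by (induct \<beta>) (auto simp: h_def uzero)
    then show ?thesis by (simp add: V_def)
  qed
  have lobV: "lob_transition p N X (V L) \<beta> = ennreal ((\<Prod>x\<in>#\<beta> - {#price \<beta>#}. h L x) *
      (p * h L (price \<beta>) * (1 - U (price \<beta> - L)) + (1 - p)))" if "\<beta> \<noteq> {#}" for L \<beta>
    using lob_transition_prod[of "h L" \<beta>] h that by (simp add: V_def[abs_def] hint)
  have Vdrift: "lob_transition p N X (V L) \<beta> \<le> V L \<beta>" for L \<beta>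
  proof (cases "\<beta> = {#}")
    case True
    then show ?thesis using h(2)[of L 0] by (simp add: lob_transition_def V_def)
  next
    case False
    let ?Q = "\<Prod>x\<in>#\<beta> - {#price \<beta>#}. h L x"
    have "0 \<le> ?Q" using prod_over_book_bounds[of "\<beta> - {#price \<beta>#}" "h L" 1] h by (force simp: less_imp_le)
    then have "?Q * (p * h L (price \<beta>) * (1 - U (price \<beta> - L)) + (1 - p)) \<le> ?Q * h L (price \<beta>)"
      by (rule mult_left_mono[OF hdrift])
    also have "?Q * h L (price \<beta>) = (\<Prod>x\<in>#\<beta>. h L x)"
      using price_in_book[OF False] by (metis image_mset_add_mset insert_DiffM mult.commute prod_mset.insert)
    finally show ?thesis using lobV[OF False, of L] by (simp add: V_def ennreal_leI)
  qed
  \<comment> \<open>if the price is within \<open>d\<close> below \<open>L\<close>, a jump of size more than \<open>2 d\<close> brings a point above \<open>L + d\<close>,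
     which makes \<open>V L\<close> drop by at least \<open>c\<close> in mean; so such prices occur finitely often\<close>
  obtain d' where d': "0 < d'" "0 < measure N {v \<in> space N. d' < X v}"
    using N.pos_prob_above[OF X_meas X_pos] .
  define d where "d = d' / 2"
  have d: "0 < d" using d' by (simp add: d_def)
  define c where "c = p * (u d * measure N {v \<in> space N. d' < X v})"
  have c: "0 < c" using d' d upos p_gt by (simp add: c_def)
  have Ud: "u d * measure N {v \<in> space N. d' < X v} \<le> U y" if "- d \<le> y" for y
  proof -
    have "(\<integral>v. u d * indicator {v \<in> space N. d' < X v} v \<partial>N) \<le> U y"
      unfolding U_def
    proof (rule integral_mono)
      show "integrable N (\<lambda>v. u d * indicator {v \<in> space N. d' < X v} v)"
        by (simp add: N.emeasure_eq_measure)
      show "u d * indicator {v \<in> space N. d' < X v} v \<le> u (y + X v)" for v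
        using umono[of d "y + X v"] u0[of "y + X v"] that by (auto simp: indicator_def d_def)
    qed (rule uint)
    then show ?thesis by simp
  qed
  have visits: "AE \<omega> in M. eventually (\<lambda>n. B n \<omega> \<notin> {\<beta>. \<beta> \<noteq> {#} \<and> price \<beta> \<in> {L - d..<L}}) sequentially" for L
  proof (rule lyapunov_finitely_often[OF _ Vfin _ c])
    have "{\<beta>. \<beta> \<noteq> {#} \<and> price \<beta> \<in> {L - d..<L}} = {\<beta>. price \<beta> \<in> {L - d..<L}} - {\<beta>. book_mass \<beta> UNIV = 0}"
      by (auto simp: book_mass_UNIV)
    moreover have "{\<beta>. price \<beta> \<in> {L - d..<L}} \<in> sets book_algebra"
      using measurable_sets[OF measurable_price, of "{L - d..<L}"] by (simp add: vimage_def)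
    ultimately show "{\<beta>. \<beta> \<noteq> {#} \<and> price \<beta> \<in> {L - d..<L}} \<in> sets book_algebra"
      using sets_book_mass[of UNIV 0] by auto
    fix \<beta>
    show "lob_transition p N X (V L) \<beta> + ennreal c * indicator {\<beta>. \<beta> \<noteq> {#} \<and> price \<beta> \<in> {L - d..<L}} \<beta> \<le> V L \<beta>"
    proof (cases "\<beta> \<noteq> {#} \<and> price \<beta> \<in> {L - d..<L}")
      case False
      then show ?thesis using Vdrift[of L \<beta>] by simp
    next
      case True
      then have below: "x < L" if "x \<in># \<beta>" for x using le_price[OF that] by auto
      have "(\<Prod>x\<in>#\<beta> - {#price \<beta>#}. h L x) = 1"
        using V_below[of "\<beta> - {#price \<beta>#}" L] below by (metis V_def ennreal_eq_1 in_diffD)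
      moreover have "h L (price \<beta>) = 1" using True by (auto simp: h_def uzero)
      ultimately have "lob_transition p N X (V L) \<beta> = ennreal (1 - p * U (price \<beta> - L))"
        using lobV[of \<beta> L] True by (simp add: algebra_simps)
      moreover have "c \<le> p * U (price \<beta> - L)"
        unfolding c_def using Ud[of "price \<beta> - L"] True p_nonneg by (intro mult_left_mono) auto
      moreover have "p * U y \<le> 1" for y
      proof -
        have "U y \<le> (\<integral>v. 1 \<partial>N)" unfolding U_def
          by (rule integral_mono[OF uint]) (use ut t in \<open>auto intro: less_imp_le le_less_trans\<close>)
        moreover have "0 \<le> U y" unfolding U_def by (simp add: u0)
        ultimately show ?thesis using p_le p_nonneg by (simp add: N.prob_space mult_le_one)
      qed
      ultimately show ?thesis
        using True V_below[of \<beta> L] below c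
        by (simp add: ennreal_plus[symmetric] ennreal_le_1 del: ennreal_plus)
    qed
  qed simp
  \<comment> \<open>every point that exceeds \<open>L\<close> by at least 1 contributes a factor of at most \<open>1 - u 1 \<le> s\<close> to \<open>V L\<close>,
     so \<open>V L \<beta> \<le> s ^ size \<beta>\<close> once \<open>L\<close> is far below the whole book\<close>
  define s where "s = max (1 / (2 * p)) (1 - u 1)"
  have s: "1 - p < p * s" "s < 1"
  proof -
    have "p * (1 / (2 * p)) \<le> p * s" using p_nonneg by (intro mult_left_mono) (auto simp: s_def)
    then show "1 - p < p * s" using p_gt by simp
    show "s < 1" using p_gt upos[of 1] by (simp add: s_def)
  qed
  obtain \<kappa> where \<kappa>: "0 < \<kappa>" "\<kappa> < 1" and
    decay: "\<And>n. (\<integral>\<^sup>+\<omega>. ennreal (s ^ size (B n \<omega>)) \<partial>M) \<le> ennreal (\<kappa> ^ n)"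
    using expectation_size_power[OF s] by blast
  define D where "D = {\<omega> \<in> space M. \<forall>n. \<forall>k::nat. \<exists>m\<ge>n. price (B m \<omega>) < - real k}"
  have Dsets [measurable]: "D \<in> sets M" unfolding D_def by measurable
  have "emeasure M D \<le> ennreal (\<kappa> ^ n)" for n
  proof -
    have "emeasure M D \<le> (\<integral>\<^sup>+\<omega>. V (- real k) (B n \<omega>) \<partial>M)" for k
    proof -
      have "emeasure M D \<le> emeasure M {\<omega> \<in> space M. \<exists>m\<ge>n. B m \<omega> \<in> {\<beta>. price \<beta> < - real k}}"
        by (rule emeasure_mono) (auto simp: D_def)
      also have "\<dots> \<le> (\<integral>\<^sup>+\<omega>. V (- real k) (B n \<omega>) \<partial>M)"
      proof (rule maximal_inequality[OF _ Vfin Vdrift])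
        show "{\<beta>. price \<beta> < - real k} \<in> sets book_algebra"
          using measurable_sets[OF measurable_price, of "{..<- real k}"] by (simp add: vimage_def)
        fix \<beta> assume "\<beta> \<in> {\<beta>. price \<beta> < - real k}"
        then have "\<And>x. x \<in># \<beta> \<Longrightarrow> x < - real k" using le_price by fastforce
        then show "1 \<le> V (- real k) \<beta>" by (subst V_below) auto
      qed simp
      finally show ?thesis .
    qed
    then have "emeasure M D \<le> (INF k. \<integral>\<^sup>+\<omega>. V (- real k) (B n \<omega>) \<partial>M)" by (rule INF_greatest)
    also have "\<dots> = (\<integral>\<^sup>+\<omega>. (INF k. V (- real k) (B n \<omega>)) \<partial>M)"
    proof (rule nn_integral_monotone_convergence_INF_decseq[symmetric, where i = 0])
      show "decseq (\<lambda>k \<omega>. V (- real k) (B n \<omega>))"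
      proof (intro decseq_SucI le_funI)
        fix k \<omega>
        have "(\<Prod>x\<in>#\<beta>. h (- real (Suc k)) x) \<le> (\<Prod>x\<in>#\<beta>. h (- real k) x)" for \<beta>
        proof (induct \<beta>)
          case (add y \<beta>)
          have "h (- real (Suc k)) y \<le> h (- real k) y" by (simp add: h_def umono)
          with add show ?case
            using h[of "- real k" y] prod_over_book_bounds[of \<beta> "h (- real (Suc k))" 1] h
            by (simp add: mult_mono less_imp_le del: of_nat_Suc)
        qed simp
        then show "V (- real (Suc k)) (B n \<omega>) \<le> V (- real k) (B n \<omega>)"
          unfolding V_def by (rule ennreal_leI)
      qed
      have "(\<integral>\<^sup>+\<omega>. V (- real 0) (B n \<omega>) \<partial>M) \<le> (\<integral>\<^sup>+\<omega>. 1 \<partial>M)"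
        by (rule nn_integral_mono)
          (use prod_over_book_bounds[of _ "h 0" 1] h in \<open>auto simp: V_def less_imp_le\<close>)
      then show "(\<integral>\<^sup>+\<omega>. V (- real 0) (B n \<omega>) \<partial>M) < \<infinity>"
        by (simp add: M.emeasure_space_1 le_less_trans)
    qed measurable
    also have "\<dots> \<le> (\<integral>\<^sup>+\<omega>. ennreal (s ^ size (B n \<omega>)) \<partial>M)"
    proof (rule nn_integral_mono)
      fix \<omega>
      obtain k :: nat where k: "\<And>x. x \<in># B n \<omega> \<Longrightarrow> 1 \<le> x + real k"
      proof -
        obtain k :: nat where k: "1 - Min (set_mset (B n \<omega>)) \<le> real k" using real_arch_simple by blast
        show ?thesis
        proof (rule that[of k])
          fix x assume "x \<in># B n \<omega>"
          then have "Min (set_mset (B n \<omega>)) \<le> x" by simp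
          then show "1 \<le> x + real k" using k by simp
        qed
      qed
      have "(\<Prod>x\<in>#B n \<omega>. h (- real k) x) \<le> s ^ size (B n \<omega>)"
      proof -
        have "0 \<le> h (- real k) x \<and> h (- real k) x \<le> s" if "x \<in># B n \<omega>" for x
          using h[of "- real k" x] umono[OF k[OF that]] by (auto simp: h_def s_def)
        then show ?thesis using prod_over_book_bounds by blast
      qed
      then have "V (- real k) (B n \<omega>) \<le> ennreal (s ^ size (B n \<omega>))"
        unfolding V_def by (rule ennreal_leI)
      then show "(INF k. V (- real k) (B n \<omega>)) \<le> ennreal (s ^ size (B n \<omega>))"
        by (rule INF_lower2[rotated]) simp
    qed
    also note decay
    finally show ?thesis .
  qed
  moreover have "(\<lambda>n. ennreal (\<kappa> ^ n)) \<longlonglongrightarrow> ennreal 0"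
    by (intro tendsto_ennrealI LIMSEQ_power_zero) (use \<kappa> in auto)
  ultimately have "emeasure M D \<le> ennreal 0"
    by (intro LIMSEQ_le_const) auto
  then have "D \<in> null_sets M" by (intro null_setsI) auto
  then have "AE \<omega> in M. \<omega> \<notin> D" by (rule AE_not_in)
  moreover have "AE \<omega> in M. \<forall>j::int. eventually (\<lambda>n. B n \<omega> \<notin>
      {\<beta>. \<beta> \<noteq> {#} \<and> price \<beta> \<in> {of_int j * d - d..<of_int j * d}}) sequentially"
    using visits by (simp add: AE_all_countable)
  ultimately show ?thesis
    using eventually_nonempty AE_space
  proof eventually_elim
    case (elim \<omega>)
    obtain n0 k where "\<And>m. m \<ge> n0 \<Longrightarrow> - real k \<le> price (B m \<omega>)"
      using elim(1,4) by (auto simp: D_def not_less)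
    then have lower: "eventually (\<lambda>n. - real k \<le> price (B n \<omega>)) sequentially"
      by (auto simp: eventually_sequentially)
    show ?case unfolding filterlim_at_top
    proof
      fix Z
      \<comment> \<open>finitely many intervals of length \<open>d\<close> cover the prices between \<open>- k\<close> and \<open>Z\<close>\<close>
      define J where "J = {\<lfloor>- real k / d\<rfloor> + 1..\<lfloor>Z / d\<rfloor> + 1}"
      have "eventually (\<lambda>n. \<forall>j\<in>J. B n \<omega> \<notin> {\<beta>. \<beta> \<noteq> {#} \<and> price \<beta> \<in> {of_int j * d - d..<of_int j * d}}) sequentially"
        using elim(2) by (subst eventually_ball_finite_distrib) (auto simp: J_def)
      with lower elim(3) show "eventually (\<lambda>n. Z \<le> price (B n \<omega>)) sequentially"
      proof eventually_elim
        case (elim n)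
        show ?case
        proof (rule ccontr)
          assume "\<not> Z \<le> price (B n \<omega>)"
          then have less: "price (B n \<omega>) < Z" by simp
          define j where "j = \<lfloor>price (B n \<omega>) / d\<rfloor> + 1"
          have "j \<in> J"
            unfolding J_def j_def
            using divide_right_mono[OF elim(1), of d] divide_right_mono[OF less_imp_le[OF less], of d] d
            by (auto intro!: floor_mono)
          moreover have "price (B n \<omega>) \<in> {of_int j * d - d..<of_int j * d}"
          proof -
            have "of_int (j - 1) \<le> price (B n \<omega>) / d" "price (B n \<omega>) / d < of_int j"
              by (auto simp: j_def)
            then show ?thesis using d by (simp add: field_simps)
          qed
          ultimately show False using elim(2,3) by blast
        qed
      qed
    qed
  qed
qed

end

section \<open>Subsolutions of the killed branching equation\<close>

context prob_space
begin

text \<open>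
  With \<open>Y = min X R\<close> of positive mean \<open>b\<close>, the function \<open>min (x + b) K\<close>, cut off to zero on the
  negative half line, is a subsolution: far below the cap, the drift \<open>b\<close> compensates the loss of at
  most \<open>b\<close> caused by the cut at zero; near the cap, the deficit is bounded and absorbed by the factor
  \<open>\<nu> < 1\<close> as soon as \<open>K\<close> is large. The chosen \<open>K\<close> is the smallest that this estimate allows.
\<close>

lemma subsolution_positive_mean:
  fixes X :: "'a \<Rightarrow> real"
  assumes int [measurable]: "integrable M X" and mean: "0 < expectation X" and \<nu>: "0 < \<nu>" "\<nu> < 1"
  obtains W :: "real \<Rightarrow> real" and C where "mono W" "\<And>x. x < 0 \<Longrightarrow> W x = 0" "\<And>x. 0 < x \<Longrightarrow> 0 < W x"
    "\<And>x. W x \<le> C" "\<And>x. \<nu> * W x \<le> expectation (\<lambda>v. W (x + X v))"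
proof -
  have X [measurable]: "X \<in> borel_measurable M" using int by simp
  have intmin: "integrable M (\<lambda>v. min (X v) r)" for r
    using int by (intro integrable_min) auto
  have "(\<lambda>n. expectation (\<lambda>v. min (X v) (real n))) \<longlonglongrightarrow> expectation X"
  proof (rule integral_dominated_convergence[where w = "\<lambda>v. \<bar>X v\<bar>"])
    have "(\<lambda>n. min (X v) (real n)) \<longlonglongrightarrow> X v" for v
    proof (rule tendsto_eventually)
      obtain m :: nat where "X v \<le> real m" using real_arch_simple by blast
      then have "\<forall>n\<ge>m. min (X v) (real n) = X v" by (auto simp: min_def)
      then show "eventually (\<lambda>n. min (X v) (real n) = X v) sequentially"
        by (auto simp: eventually_sequentially)
    qed
    then show "AE v in M. (\<lambda>n. min (X v) (real n)) \<longlonglongrightarrow> X v" by simp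
  qed (use int in auto)
  then have "eventually (\<lambda>n. 0 < expectation (\<lambda>v. min (X v) (real n))) sequentially"
    using mean by (rule order_tendstoD)
  then obtain n :: nat where n: "0 < expectation (\<lambda>v. min (X v) (real n))"
    by (auto simp: eventually_sequentially)
  define R where "R = real n"
  define Y where "Y v = min (X v) R" for v
  have intY: "integrable M Y" unfolding Y_def by (rule intmin)
  define b where "b = expectation Y"
  have b: "0 < b" using n by (simp add: b_def Y_def[abs_def] R_def)
  have R: "0 \<le> R" by (simp add: R_def)
  define A where "A = expectation (\<lambda>v. \<bar>Y v\<bar>)"
  have A: "0 \<le> A" by (simp add: A_def)
  define K where "K = (R + b + A) / (1 - \<nu>)"
  have K: "K - R - b - A = \<nu> * K" using \<nu> by (simp add: K_def field_simps)
  have K0: "0 < K" using \<nu> b R A by (simp add: K_def)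
  define W where "W x = (if x < 0 then 0 else min (x + b) K)" for x
  have mono: "mono W" by (rule monoI) (use b K0 in \<open>auto simp: W_def\<close>)
  have W0: "0 \<le> W x" for x using b K0 by (auto simp: W_def)
  have WK: "W x \<le> K" for x using K0 by (auto simp: W_def)
  have [measurable]: "W \<in> borel_measurable borel" by (rule borel_measurable_mono[OF mono])
  have Wint: "integrable M (\<lambda>v. W (x + X v))" for x
    by (rule integrable_const_bound[of _ K]) (use W0 WK in auto)
  have WY: "W (x + Y v) \<le> W (x + X v)" for x v
    by (rule monoD[OF mono]) (simp add: Y_def)
  show ?thesis
  proof (rule that[OF mono])
    show "W x = 0" if "x < 0" for x using that by (simp add: W_def)
    show "0 < W x" if "0 < x" for x using that b K0 by (simp add: W_def)
    show "W x \<le> K" for x by (rule WK)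
    show "\<nu> * W x \<le> expectation (\<lambda>v. W (x + X v))" for x
    proof (cases "x < 0")
      case True
      then show ?thesis using W0 by (simp add: W_def[of x] Bochner_Integration.integral_nonneg)
    next
      case x: False
      show ?thesis
      proof (cases "x + b \<le> K - R")
        case True
        have "expectation (\<lambda>v. x + Y v) \<le> expectation (\<lambda>v. W (x + X v))"
        proof (rule integral_mono[OF _ Wint])
          show "integrable M (\<lambda>v. x + Y v)" using intY by simp
          fix v
          have "Y v \<le> R" by (simp add: Y_def)
          then have "x + Y v \<le> W (x + Y v)" using True b by (auto simp: W_def)
          then show "x + Y v \<le> W (x + X v)" using WY order_trans by blast
        qed
        also have "expectation (\<lambda>v. x + Y v) = x + b"
          using intY by (simp add: b_def prob_space)
        finally have "W x \<le> expectation (\<lambda>v. W (x + X v))" using x True R by (simp add: W_def[of x])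
        moreover have "\<nu> * W x \<le> 1 * W x" using \<nu> W0 by (intro mult_right_mono) auto
        ultimately show ?thesis by simp
      next
        case False
        have "expectation (\<lambda>v. K - R - b - \<bar>Y v\<bar>) \<le> expectation (\<lambda>v. W (x + X v))"
        proof (rule integral_mono[OF _ Wint])
          show "integrable M (\<lambda>v. K - R - b - \<bar>Y v\<bar>)" using intY by simp
          fix v
          have "K - R - b - \<bar>Y v\<bar> \<le> W (x + Y v)" using False b R by (auto simp: W_def)
          then show "K - R - b - \<bar>Y v\<bar> \<le> W (x + X v)" using WY order_trans by blast
        qed
        also have "expectation (\<lambda>v. K - R - b - \<bar>Y v\<bar>) = K - R - b - A"
          using intY by (simp add: A_def prob_space)
        finally have "\<nu> * K \<le> expectation (\<lambda>v. W (x + X v))" by (simp add: K)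
        moreover have "\<nu> * W x \<le> \<nu> * K" using \<nu> WK by (intro mult_left_mono) auto
        ultimately show ?thesis by simp
      qed
    qed
  qed
qed

end

text \<open>
  Here \<open>g\<close> is the density of a finite measure of mass \<open>c > \<nu>\<close> under which \<open>Y\<close> is bounded and
  centred. On the parabola \<open>x (K - x)\<close> itself the kernel acts as multiplication by \<open>c\<close> minus the
  constant second moment \<open>S\<close>. In the middle of \<open>[0, K]\<close> the parabola is large and the gap \<open>c - \<nu>\<close>
  absorbs \<open>S\<close>. Within \<open>\<delta>\<close> of an end point, taking the positive part gains at least
  \<open>K (m - \<delta> c)\<close>, where \<open>m\<close> is the mean of the negative (equivalently positive) part of \<open>Y\<close>; this
  exceeds \<open>S\<close> for large \<open>K\<close>.
\<close>

lemma parabola_subsolution: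
  fixes Y g :: "'a \<Rightarrow> real"
  assumes [measurable]: "Y \<in> borel_measurable M" and g: "integrable M g" "\<And>v. 0 \<le> g v"
    and bounded: "\<And>v. g v \<noteq> 0 \<Longrightarrow> \<bar>Y v\<bar> \<le> R"
    and centred: "(\<integral>v. Y v * g v \<partial>M) = 0" and nondeg: "0 < (\<integral>v. \<bar>Y v\<bar> * g v \<partial>M)"
    and \<nu>: "\<nu> < (\<integral>v. g v \<partial>M)"
  obtains K where "0 < K"
    "\<And>x. \<nu> * max 0 (x * (K - x)) \<le> (\<integral>v. max 0 ((x + Y v) * (K - (x + Y v))) * g v \<partial>M)"
proof -
  have [measurable]: "g \<in> borel_measurable M" using g by simp
  have weighted: "integrable M (\<lambda>v. f v * g v)"
    if [measurable]: "f \<in> borel_measurable M" and le: "\<And>v. g v \<noteq> 0 \<Longrightarrow> \<bar>f v\<bar> \<le> r" for f r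
  proof (rule Bochner_Integration.integrable_bound[of M "\<lambda>v. r * g v"])
    show "integrable M (\<lambda>v. r * g v)" using g by simp
    have "\<bar>f v * g v\<bar> \<le> \<bar>r * g v\<bar>" for v
      using le[of v] g(2)[of v] by (cases "g v = 0") (auto simp: abs_mult intro!: mult_right_mono)
    then show "AE v in M. norm (f v * g v) \<le> norm (r * g v)" by simp
  qed simp
  define c where "c = (\<integral>v. g v \<partial>M)"
  define S where "S = (\<integral>v. (Y v)\<^sup>2 * g v \<partial>M)"
  define m where "m = (\<integral>v. \<bar>Y v\<bar> * g v \<partial>M) / 2"
  define \<delta> where "\<delta> = m / (2 * (\<bar>c\<bar> + 1))"
  have S: "0 \<le> S" unfolding S_def using g by (intro Bochner_Integration.integral_nonneg) auto
  have m: "0 < m" using nondeg by (simp add: m_def)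
  have \<delta>: "0 < \<delta>" using m by (simp add: \<delta>_def add_nonneg_pos)
  have c0: "0 \<le> c" unfolding c_def using g by (intro Bochner_Integration.integral_nonneg) auto
  have \<delta>c: "\<delta> * c \<le> m / 2" using m c0 by (simp add: \<delta>_def field_simps)
  have c\<nu>: "0 < c - \<nu>" using \<nu> by (simp add: c_def)
  define K where "K = 2 * \<delta> + 2 * S / m + S / ((c - \<nu>) * \<delta>)"
  have K: "2 * \<delta> \<le> K" "2 * S / m \<le> K" "S / ((c - \<nu>) * \<delta>) \<le> K - \<delta>"
    using S m \<delta> c\<nu> by (auto simp: K_def)
  have K0: "0 < K" using K \<delta> by simp
  have Km: "S \<le> K * (m / 2)" using K(2) m by (simp add: field_simps)
  have KS: "S \<le> (c - \<nu>) * (\<delta> * (K - \<delta>))"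
    using K(3) \<delta> c\<nu> by (simp add: pos_divide_le_eq ac_simps)
  define q where "q x = max 0 (x * (K - x))" for x
  have q0: "0 \<le> q x" for x by (simp add: q_def)
  have qK: "q x \<le> K\<^sup>2" for x
  proof -
    have "0 \<le> (K - 2 * x)\<^sup>2" by simp
    then have "4 * (x * (K - x)) \<le> K\<^sup>2" by (simp add: power2_eq_square algebra_simps)
    then have "x * (K - x) \<le> K\<^sup>2" using zero_le_power2[of K] by linarith
    then show ?thesis by (simp add: q_def)
  qed
  have [measurable]: "q \<in> borel_measurable borel" unfolding q_def by measurable
  have int1: "integrable M (\<lambda>v. Y v * g v)" by (rule weighted[of _ R]) (use bounded in auto)
  have intabs: "integrable M (\<lambda>v. \<bar>Y v\<bar> * g v)" by (rule weighted[of _ R]) (use bounded in auto)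
  have int2: "integrable M (\<lambda>v. (Y v)\<^sup>2 * g v)"
  proof (rule weighted[of _ "R\<^sup>2"])
    show "\<bar>(Y v)\<^sup>2\<bar> \<le> R\<^sup>2" if "g v \<noteq> 0" for v
      using power_mono[OF bounded[OF that], of 2] by simp
  qed simp
  have intq: "integrable M (\<lambda>v. q (x + Y v) * g v)" for x
    by (rule weighted[of _ "K\<^sup>2"]) (use q0 qK in auto)
  \<comment> \<open>integrates a pointwise lower bound; the linear term \<open>\<sigma> y\<close> disappears because \<open>Y\<close> is centred\<close>
  have lower: "x * (K - x) * c - S + \<alpha> * (2 * m) + \<gamma> * c \<le> (\<integral>v. q (x + Y v) * g v \<partial>M)"
    if le: "\<And>y. (x + y) * (K - (x + y)) + \<sigma> * y + \<alpha> * \<bar>y\<bar> + \<gamma> \<le> q (x + y)" for x \<alpha> \<gamma> \<sigma>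
  proof -
    have "(\<integral>v. x * (K - x) * g v + (K - 2 * x + \<sigma>) * (Y v * g v) - (Y v)\<^sup>2 * g v + \<alpha> * (\<bar>Y v\<bar> * g v) + \<gamma> * g v \<partial>M)
        \<le> (\<integral>v. q (x + Y v) * g v \<partial>M)"
    proof (rule integral_mono[OF _ intq])
      fix v
      have "((x + Y v) * (K - (x + Y v)) + \<sigma> * Y v + \<alpha> * \<bar>Y v\<bar> + \<gamma>) * g v \<le> q (x + Y v) * g v"
        by (rule mult_right_mono[OF le g(2)])
      then show "x * (K - x) * g v + (K - 2 * x + \<sigma>) * (Y v * g v) - (Y v)\<^sup>2 * g v + \<alpha> * (\<bar>Y v\<bar> * g v) + \<gamma> * g v
          \<le> q (x + Y v) * g v"
        by (simp add: algebra_simps power2_eq_square)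
    qed (use int1 int2 intabs g in simp)
    then show ?thesis
      using int1 int2 intabs g by (simp add: centred c_def S_def m_def)
  qed
  show ?thesis
  proof (rule that[OF K0])
    fix x
    have "\<nu> * q x \<le> (\<integral>v. q (x + Y v) * g v \<partial>M)"
    proof -
      consider "x \<le> 0 \<or> K \<le> x" | "0 < x" "x < \<delta>" | "\<delta> \<le> x" "x \<le> K - \<delta>" | "K - \<delta> < x" "x < K"
        by linarith
      then show ?thesis
      proof cases
        case 1
        then have "x * (K - x) \<le> 0" using K0 by (auto intro: mult_nonpos_nonneg mult_nonneg_nonpos)
        then have "q x = 0" by (simp add: q_def)
        then show ?thesis using q0 g by (simp add: Bochner_Integration.integral_nonneg)
      next
        case 2
        \<comment> \<open>the gain is \<open>K (y\<^sup>- - \<delta>)\<close>, with the negative part written as \<open>(\<bar>y\<bar> - y) / 2\<close>\<close>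
        have "x * (K - x) * c - S + K / 2 * (2 * m) + - (K * \<delta>) * c \<le> (\<integral>v. q (x + Y v) * g v \<partial>M)"
        proof (rule lower[where \<sigma> = "- (K / 2)"])
          fix y
          show "(x + y) * (K - (x + y)) + - (K / 2) * y + K / 2 * \<bar>y\<bar> + - (K * \<delta>) \<le> q (x + y)"
          proof (cases "x + y < 0")
            case True
            then have "(x + y) * (K - (x + y)) \<le> (x + y) * K" by (intro mult_left_mono_neg) auto
            moreover have "- (K / 2) * y + K / 2 * \<bar>y\<bar> = K * (- y)" using True 2 by simp
            moreover have "(x + y) * K + K * (- y) \<le> K * \<delta>" using 2 K0 by (simp add: algebra_simps)
            ultimately show ?thesis using q0[of "x + y"] by linarith
          next
            case False
            have "- (K / 2) * y + K / 2 * \<bar>y\<bar> = K * ((\<bar>y\<bar> - y) / 2)" by (simp add: algebra_simps)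
            also have "\<dots> \<le> K * \<delta>" using False 2 K0 \<delta> by (intro mult_left_mono) auto
            finally show ?thesis by (simp add: q_def)
          qed
        qed
        moreover have "K * (\<delta> * c) \<le> K * (m / 2)" using \<delta>c K0 by (intro mult_left_mono) auto
        ultimately have "x * (K - x) * c \<le> (\<integral>v. q (x + Y v) * g v \<partial>M)" using Km by (simp add: algebra_simps)
        moreover have "q x = x * (K - x)" using 2 K \<delta> by (simp add: q_def)
        moreover have "\<nu> * q x \<le> c * q x" using c\<nu> q0 by (intro mult_right_mono) auto
        ultimately show ?thesis by (simp add: mult.commute)
      next
        case 3
        have "x * (K - x) * c - S + 0 * (2 * m) + 0 * c \<le> (\<integral>v. q (x + Y v) * g v \<partial>M)"
          by (rule lower[where \<sigma> = 0]) (simp add: q_def)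
        moreover have qx: "q x = x * (K - x)" using 3 \<delta> by (simp add: q_def)
        moreover have "\<delta> * (K - \<delta>) \<le> x * (K - x)"
        proof -
          have "0 \<le> (x - \<delta>) * (K - \<delta> - x)" using 3 by (intro mult_nonneg_nonneg) auto
          then show ?thesis by (simp add: algebra_simps)
        qed
        then have "S \<le> (c - \<nu>) * (x * (K - x))"
          using KS c\<nu> by (meson less_imp_le mult_left_mono order_trans)
        then have "\<nu> * (x * (K - x)) \<le> x * (K - x) * c - S" by (simp add: algebra_simps)
        ultimately show ?thesis by simp
      next
        case 4
        \<comment> \<open>the gain is \<open>K (y\<^sup>+ - \<delta>)\<close>, with the positive part written as \<open>(\<bar>y\<bar> + y) / 2\<close>\<close>
        have "x * (K - x) * c - S + K / 2 * (2 * m) + - (K * \<delta>) * c \<le> (\<integral>v. q (x + Y v) * g v \<partial>M)"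
        proof (rule lower[where \<sigma> = "K / 2"])
          fix y
          show "(x + y) * (K - (x + y)) + K / 2 * y + K / 2 * \<bar>y\<bar> + - (K * \<delta>) \<le> q (x + y)"
          proof (cases "K < x + y")
            case True
            then have "(x + y) * (K - (x + y)) \<le> K * (K - (x + y))" by (intro mult_right_mono_neg) auto
            moreover have "K / 2 * y + K / 2 * \<bar>y\<bar> = K * y" using True 4 by simp
            moreover have "K * (K - (x + y)) + K * y \<le> K * \<delta>"
            proof -
              have "K * (K - x) \<le> K * \<delta>" using 4 K0 by (intro mult_left_mono) auto
              then show ?thesis by (simp add: algebra_simps)
            qed
            ultimately show ?thesis using q0[of "x + y"] by linarith
          next
            case False
            have "K / 2 * y + K / 2 * \<bar>y\<bar> = K * ((\<bar>y\<bar> + y) / 2)" by (simp add: algebra_simps)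
            also have "\<dots> \<le> K * \<delta>" using False 4 K0 \<delta> by (intro mult_left_mono) auto
            finally show ?thesis by (simp add: q_def)
          qed
        qed
        moreover have "K * (\<delta> * c) \<le> K * (m / 2)" using \<delta>c K0 by (intro mult_left_mono) auto
        ultimately have "x * (K - x) * c \<le> (\<integral>v. q (x + Y v) * g v \<partial>M)" using Km by (simp add: algebra_simps)
        moreover have "q x = x * (K - x)" using 4 K \<delta> by (simp add: q_def)
        moreover have "\<nu> * q x \<le> c * q x" using c\<nu> q0 by (intro mult_right_mono) auto
        ultimately show ?thesis by (simp add: mult.commute)
      qed
    qed
    then show "\<nu> * max 0 (x * (K - x)) \<le> (\<integral>v. max 0 ((x + Y v) * (K - (x + Y v))) * g v \<partial>M)"
      by (simp add: q_def)
  qed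
qed

lemma (in prob_space) continuous_tilted_integral:
  fixes Z X :: "'a \<Rightarrow> real"
  assumes [measurable]: "Z \<in> borel_measurable M" "X \<in> borel_measurable M"
    and Z: "\<And>v. \<bar>Z v\<bar> \<le> r" and X: "\<And>v. Z v \<noteq> 0 \<Longrightarrow> \<bar>X v\<bar> \<le> r"
  shows "continuous_on UNIV (\<lambda>\<theta>. expectation (\<lambda>v. Z v * exp (\<theta> * X v)))"
  unfolding continuous_on_sequentially
proof (intro ballI allI impI, unfold o_def)
  fix t :: "nat \<Rightarrow> real" and \<theta>
  assume "(\<forall>n. t n \<in> UNIV) \<and> t \<longlonglongrightarrow> \<theta>"
  then have t: "t \<longlonglongrightarrow> \<theta>" by simp
  then have "Bseq t" by (intro convergent_imp_Bseq) (auto simp: convergent_def)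
  then obtain T where T: "\<And>n. \<bar>t n\<bar> \<le> T" by (auto simp: Bseq_def)
  show "(\<lambda>n. expectation (\<lambda>v. Z v * exp (t n * X v))) \<longlonglongrightarrow> expectation (\<lambda>v. Z v * exp (\<theta> * X v))"
  proof (rule integral_dominated_convergence[where w = "\<lambda>_. r * exp (T * r)"])
    show "AE v in M. (\<lambda>n. Z v * exp (t n * X v)) \<longlonglongrightarrow> Z v * exp (\<theta> * X v)"
      by (intro AE_I2 tendsto_intros t)
    have "\<bar>Z v * exp (t n * X v)\<bar> \<le> r * exp (T * r)" for n v
    proof (cases "Z v = 0")
      case True
      then show ?thesis using Z[of v] by simp
    next
      case False
      have "t n * X v \<le> \<bar>t n\<bar> * \<bar>X v\<bar>" by (metis abs_ge_self abs_mult)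
      also have "\<dots> \<le> T * r" using T[of n] X[OF False] by (intro mult_mono) auto
      finally show ?thesis using Z[of v] by (auto simp: abs_mult intro!: mult_mono)
    qed
    then show "AE v in M. norm (Z v * exp (t n * X v)) \<le> r * exp (T * r)" for n by simp
  qed auto
qed

context prob_space
begin

text \<open>
  For \<open>X\<close> restricted to \<open>[-n, n]\<close>, let \<open>\<phi> n\<close> be the restricted moment generating function and \<open>\<psi> n\<close>
  its derivative. For large \<open>n\<close>, \<open>\<psi> n\<close> is negative at 0 and positive far out, so it has a zero
  \<open>\<theta> \<ge> 0\<close>. If \<open>\<phi> n \<le> \<nu>\<close> at all these zeros, the sets where \<open>\<phi> n \<le> \<nu>\<close> form a decreasing sequence
  of nonempty compact sets; at a common point, monotone convergence would give a full moment
  generating function of at most \<open>\<nu>\<close>.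
\<close>

lemma centring_tilt:
  fixes X :: "'a \<Rightarrow> real"
  assumes int: "integrable M X" and mean: "expectation X < 0"
    and pos: "0 < prob {v \<in> space M. 0 < X v}" and \<nu>: "0 \<le> \<nu>"
    and mgf: "\<And>\<theta>. 0 \<le> \<theta> \<Longrightarrow> ennreal \<nu> < (\<integral>\<^sup>+ v. ennreal (exp (\<theta> * X v)) \<partial>M)"
  obtains \<theta> and R :: real where "0 \<le> \<theta>"
    "expectation (\<lambda>v. X v * (indicator {v. \<bar>X v\<bar> \<le> R} v * exp (\<theta> * X v))) = 0"
    "\<nu> < expectation (\<lambda>v. indicator {v. \<bar>X v\<bar> \<le> R} v * exp (\<theta> * X v))"
    "0 < expectation (\<lambda>v. \<bar>X v\<bar> * (indicator {v. \<bar>X v\<bar> \<le> R} v * exp (\<theta> * X v)))"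
proof -
  have X [measurable]: "X \<in> borel_measurable M" using int by simp
  define J :: "nat \<Rightarrow> 'a \<Rightarrow> real" where "J n = indicator {v. \<bar>X v\<bar> \<le> real n}" for n
  have [measurable]: "J n \<in> borel_measurable M" for n unfolding J_def by measurable
  have J: "0 \<le> J n v" "J n v \<le> 1" "J n v \<noteq> 0 \<Longrightarrow> \<bar>X v\<bar> \<le> real n" for n v
    by (auto simp: J_def indicator_def split: if_splits)
  have Jlim: "(\<lambda>n. J n v) \<longlonglongrightarrow> 1" for v
  proof (rule tendsto_eventually)
    obtain m :: nat where "\<bar>X v\<bar> \<le> real m" using real_arch_simple by blast
    then have "\<forall>n\<ge>m. J n v = 1" by (auto simp: J_def)
    then show "eventually (\<lambda>n. J n v = 1) sequentially" by (auto simp: eventually_sequentially)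
  qed
  define \<phi> where "\<phi> n \<theta> = expectation (\<lambda>v. J n v * exp (\<theta> * X v))" for n \<theta>
  define \<psi> where "\<psi> n \<theta> = expectation (\<lambda>v. X v * J n v * exp (\<theta> * X v))" for n \<theta>
  have XJ: "\<bar>X v * J n v\<bar> \<le> real n" for n v
    using J[of n v] by (cases "J n v = 0") (auto simp: abs_mult intro: order_trans[OF mult_left_mono, of _ 1])
  have \<phi>cont: "continuous_on UNIV (\<phi> n)" for n
    unfolding \<phi>_def[abs_def] by (rule continuous_tilted_integral[where r = "max 1 (real n)"]) (use J in \<open>auto simp: le_max_iff_disj\<close>)
  have \<psi>cont: "continuous_on UNIV (\<psi> n)" for n
    unfolding \<psi>_def[abs_def] by (rule continuous_tilted_integral[where r = "real n"]) (use J XJ in auto)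
  have expb: "J n v * exp (\<theta> * X v) \<le> exp (\<bar>\<theta>\<bar> * real n)" for n v \<theta>
  proof (cases "J n v = 0")
    case False
    have "\<theta> * X v \<le> \<bar>\<theta>\<bar> * \<bar>X v\<bar>" by (metis abs_ge_self abs_mult)
    also have "\<dots> \<le> \<bar>\<theta>\<bar> * real n" using J(3)[OF False] by (intro mult_left_mono) auto
    finally have le: "exp (\<theta> * X v) \<le> exp (\<bar>\<theta>\<bar> * real n)" by simp
    show ?thesis using mult_mono[OF J(2)[of n v] le] J by simp
  qed simp
  have \<phi>int: "integrable M (\<lambda>v. J n v * exp (\<theta> * X v))" for n \<theta>
    by (rule integrable_const_bound[of _ "exp (\<bar>\<theta>\<bar> * real n)"]) (use J expb in auto)
  have wint: "integrable M (\<lambda>v. f v * (J n v * exp (\<theta> * X v)))"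
    if [measurable]: "f \<in> borel_measurable M" and f: "\<And>v. \<bar>f v\<bar> \<le> \<bar>X v\<bar>" for f n \<theta>
  proof (rule integrable_const_bound[of _ "real n * exp (\<bar>\<theta>\<bar> * real n)"])
    have "\<bar>f v * (J n v * exp (\<theta> * X v))\<bar> \<le> real n * exp (\<bar>\<theta>\<bar> * real n)" for v
    proof (cases "J n v = 0")
      case False
      then have "\<bar>f v\<bar> \<le> real n" using f[of v] J(3)[of n v] by simp
      then have "\<bar>f v\<bar> * (J n v * exp (\<theta> * X v)) \<le> real n * exp (\<bar>\<theta>\<bar> * real n)"
        using expb J by (intro mult_mono) auto
      then show ?thesis using J by (simp add: abs_mult)
    qed simp
    then show "AE v in M. norm (f v * (J n v * exp (\<theta> * X v))) \<le> real n * exp (\<bar>\<theta>\<bar> * real n)" by simp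
  qed measurable
  have \<psi>int: "integrable M (\<lambda>v. X v * J n v * exp (\<theta> * X v))" for n \<theta>
    using wint[of X n \<theta>] by (simp add: mult.assoc)
  obtain d where d: "0 < d" "0 < prob {v \<in> space M. d < X v}"
    using pos_prob_above[OF X pos] .
  define Q where "Q n v = indicator {v \<in> space M. d < X v} v * J n v" for n v
  have [measurable]: "Q n \<in> borel_measurable M" for n unfolding Q_def by measurable
  have Q: "0 \<le> Q n v" "Q n v \<le> J n v" "Q n v \<noteq> 0 \<Longrightarrow> d < X v" for n v
    using J by (auto simp: Q_def indicator_def split: if_splits)
  have Q1: "Q n v \<le> 1" for n v by (rule order_trans[OF Q(2) J(2)])
  have Qint: "integrable M (Q n)" for n
    by (rule integrable_const_bound[of _ 1]) (use Q Q1 in auto)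
  have "(\<lambda>n. expectation (Q n)) \<longlonglongrightarrow> expectation (indicator {v \<in> space M. d < X v})"
  proof (rule integral_dominated_convergence[where w = "\<lambda>_. 1"])
    show "AE v in M. (\<lambda>n. Q n v) \<longlonglongrightarrow> indicator {v \<in> space M. d < X v} v"
      unfolding Q_def using tendsto_mult_left[OF Jlim] by (intro AE_I2) fastforce
  qed (use Q Q1 in auto)
  then have Qlim: "(\<lambda>n. expectation (Q n)) \<longlonglongrightarrow> prob {v \<in> space M. d < X v}"
    by simp
  define \<eta> where "\<eta> = prob {v \<in> space M. d < X v} / 2"
  have \<eta>: "0 < \<eta>" using d by (simp add: \<eta>_def)
  have evQ: "eventually (\<lambda>n. \<eta> < expectation (Q n)) sequentially"
    by (rule order_tendstoD[OF Qlim]) (use d in \<open>simp add: \<eta>_def\<close>)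
  have "(\<lambda>n. \<psi> n 0) \<longlonglongrightarrow> expectation X"
    unfolding \<psi>_def
  proof (rule integral_dominated_convergence[where w = "\<lambda>v. \<bar>X v\<bar>"])
    show "AE v in M. (\<lambda>n. X v * J n v * exp (0 * X v)) \<longlonglongrightarrow> X v"
      using tendsto_mult_left[OF Jlim] by (intro AE_I2) fastforce
    show "AE v in M. norm (X v * J n v * exp (0 * X v)) \<le> \<bar>X v\<bar>" for n
      using J by (intro AE_I2) (auto simp: abs_mult intro: mult_left_le)
  qed (use int in auto)
  then have "eventually (\<lambda>n. \<psi> n 0 < 0) sequentially" using mean by (rule order_tendstoD)
  with evQ have "eventually (\<lambda>n. \<eta> < expectation (Q n) \<and> \<psi> n 0 < 0) sequentially" by eventually_elim simp
  then obtain n0 where n0: "\<And>n. n0 \<le> n \<Longrightarrow> \<eta> < expectation (Q n) \<and> \<psi> n 0 < 0"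
    by (auto simp: eventually_sequentially)
  have expQ: "\<theta> * d * Q n v \<le> J n v * exp (\<theta> * X v)" if "0 \<le> \<theta>" for \<theta> n v
  proof (cases "Q n v = 0")
    case False
    then have "\<theta> * d \<le> \<theta> * X v" using Q(3)[of n v] that by (intro mult_left_mono) auto
    also have "\<dots> \<le> exp (\<theta> * X v)" using exp_ge_add_one_self[of "\<theta> * X v"] by linarith
    finally have "\<theta> * d * Q n v \<le> exp (\<theta> * X v) * J n v"
      using Q J by (intro mult_mono) auto
    then show ?thesis by (simp add: mult.commute)
  qed (use J in simp)
  have zero: "\<exists>\<theta>\<ge>0. \<psi> n \<theta> = 0" if n: "n0 \<le> n" for n
  proof -
    \<comment> \<open>\<open>\<psi> n \<theta> \<ge> d (\<theta> d) \<eta> - n\<close>, and \<open>\<theta>1\<close> makes the right-hand side vanish\<close>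
    define \<theta>1 where "\<theta>1 = real n / (d * d * \<eta>)"
    have \<theta>1: "0 \<le> \<theta>1" using d \<eta> by (simp add: \<theta>1_def)
    have "expectation (\<lambda>v. d * (\<theta>1 * d) * Q n v - real n) \<le> \<psi> n \<theta>1"
      unfolding \<psi>_def
    proof (rule integral_mono[OF _ \<psi>int])
      show "integrable M (\<lambda>v. d * (\<theta>1 * d) * Q n v - real n)" using Qint by simp
      fix v
      show "d * (\<theta>1 * d) * Q n v - real n \<le> X v * J n v * exp (\<theta>1 * X v)"
      proof (cases "Q n v = 0")
        case False
        then have "d * (\<theta>1 * d * Q n v) \<le> X v * (J n v * exp (\<theta>1 * X v))"
          using Q(1,3)[of n v] expQ[OF \<theta>1, of n v] d \<theta>1 by (intro mult_mono[of d]) auto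
        then show ?thesis by (simp add: ac_simps)
      next
        case True
        show ?thesis
        proof (cases "0 \<le> X v")
          case True
          then show ?thesis using \<open>Q n v = 0\<close> J by (simp add: order_trans[of _ 0])
        next
          case False
          then have "exp (\<theta>1 * X v) \<le> 1" using \<theta>1 by (simp add: mult_nonneg_nonpos)
          then have "\<bar>X v * J n v\<bar> * exp (\<theta>1 * X v) \<le> real n * 1"
            using XJ by (intro mult_mono) auto
          then have "\<bar>X v * J n v * exp (\<theta>1 * X v)\<bar> \<le> real n" by (simp add: abs_mult)
          then show ?thesis using \<open>Q n v = 0\<close> by (simp add: abs_le_iff)
        qed
      qed
    qed
    also have "expectation (\<lambda>v. d * (\<theta>1 * d) * Q n v - real n) = d * (\<theta>1 * d) * expectation (Q n) - real n"
      using Qint by (simp add: prob_space)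
    finally have "d * (\<theta>1 * d) * expectation (Q n) - real n \<le> \<psi> n \<theta>1" .
    moreover have "d * (\<theta>1 * d) * \<eta> \<le> d * (\<theta>1 * d) * expectation (Q n)"
      using n0[OF n] d \<theta>1 by (intro mult_left_mono) auto
    moreover have "d * (\<theta>1 * d) * \<eta> = real n" using d \<eta> by (simp add: \<theta>1_def)
    ultimately have "0 \<le> \<psi> n \<theta>1" by linarith
    moreover have "\<psi> n 0 \<le> 0" using n0[OF n] by simp
    ultimately obtain \<theta> where "0 \<le> \<theta>" "\<theta> \<le> \<theta>1" "\<psi> n \<theta> = 0"
      using IVT'[of "\<psi> n" 0 0 \<theta>1] \<theta>1 continuous_on_subset[OF \<psi>cont] by blast
    then show ?thesis by blast
  qed
  have \<phi>lower: "\<theta> * d * \<eta> \<le> \<phi> n \<theta>" if "n0 \<le> n" "0 \<le> \<theta>" for n \<theta>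
  proof -
    have "\<theta> * d * \<eta> \<le> \<theta> * d * expectation (Q n)"
      using n0[OF that(1)] d that by (intro mult_left_mono) auto
    also have "\<dots> = expectation (\<lambda>v. \<theta> * d * Q n v)" by simp
    also have "\<dots> \<le> \<phi> n \<theta>" unfolding \<phi>_def
      by (rule integral_mono) (use Qint \<phi>int expQ that in auto)
    finally show ?thesis .
  qed
  have \<phi>mono: "\<phi> n \<theta> \<le> \<phi> k \<theta>" if "n \<le> k" for n k \<theta>
    unfolding \<phi>_def by (rule integral_mono[OF \<phi>int \<phi>int]) (use that in \<open>auto simp: J_def indicator_def\<close>)
  have "\<exists>n\<ge>n0. \<exists>\<theta>\<ge>0. \<psi> n \<theta> = 0 \<and> \<nu> < \<phi> n \<theta>"
  proof (rule ccontr)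
    assume none: "\<not> ?thesis"
    define T where "T = \<nu> / (d * \<eta>)"
    define C where "C n = {\<theta> \<in> {0..T}. \<phi> (n0 + n) \<theta> \<le> \<nu>}" for n
    have "\<Inter>(range C) \<noteq> {}"
    proof (rule compact_nest)
      fix n
      have "C n = {0..T} \<inter> \<phi> (n0 + n) -` {..\<nu>}" by (auto simp: C_def)
      moreover have "closed (\<phi> (n0 + n) -` {..\<nu>})"
        by (rule closed_vimage[OF closed_atMost \<phi>cont])
      ultimately show "compact (C n)" by (simp add: compact_Int_closed)
      obtain \<theta> where \<theta>: "0 \<le> \<theta>" "\<psi> (n0 + n) \<theta> = 0" using zero[of "n0 + n"] by auto
      with none have le: "\<phi> (n0 + n) \<theta> \<le> \<nu>" by (meson le_add1 not_le)
      with \<phi>lower[of "n0 + n" \<theta>] \<theta> have "\<theta> * d * \<eta> \<le> \<nu>" by simp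
      then have "\<theta> \<le> T" using d \<eta> by (simp add: T_def field_simps)
      then show "C n \<noteq> {}" using \<theta> le by (auto simp: C_def)
    next
      fix m n :: nat assume "m \<le> n"
      then show "C n \<subseteq> C m" using \<phi>mono[of "n0 + m" "n0 + n"] by (auto simp: C_def intro: order_trans)
    qed
    then obtain \<theta> where "\<And>n. \<theta> \<in> C n" by blast
    then have \<theta>: "0 \<le> \<theta>" "\<And>n. \<phi> (n0 + n) \<theta> \<le> \<nu>" by (auto simp: C_def)
    have "(\<integral>\<^sup>+ v. ennreal (exp (\<theta> * X v)) \<partial>M) = (\<integral>\<^sup>+ v. (SUP n. ennreal (J (n0 + n) v * exp (\<theta> * X v))) \<partial>M)"
    proof (rule nn_integral_cong)
      fix v
      have "incseq (\<lambda>n. ennreal (J (n0 + n) v * exp (\<theta> * X v)))"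
        by (intro incseq_SucI ennreal_leI) (auto simp: J_def indicator_def)
      moreover have "(\<lambda>n. ennreal (J (n0 + n) v * exp (\<theta> * X v))) \<longlonglongrightarrow> ennreal (1 * exp (\<theta> * X v))"
        using LIMSEQ_ignore_initial_segment[OF Jlim[of v], of n0]
        by (intro tendsto_ennrealI tendsto_intros) (simp add: add.commute)
      ultimately show "ennreal (exp (\<theta> * X v)) = (SUP n. ennreal (J (n0 + n) v * exp (\<theta> * X v)))"
        by (metis LIMSEQ_SUP LIMSEQ_unique mult_1)
    qed
    also have "\<dots> = (SUP n. \<integral>\<^sup>+ v. ennreal (J (n0 + n) v * exp (\<theta> * X v)) \<partial>M)"
      by (rule nn_integral_monotone_convergence_SUP)
        (auto intro!: incseq_SucI le_funI ennreal_leI simp: J_def indicator_def)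
    also have "\<dots> \<le> ennreal \<nu>"
    proof (rule SUP_least)
      fix n
      have "(\<integral>\<^sup>+ v. ennreal (J (n0 + n) v * exp (\<theta> * X v)) \<partial>M) = ennreal (\<phi> (n0 + n) \<theta>)"
        unfolding \<phi>_def by (rule nn_integral_eq_integral[OF \<phi>int]) (use J in auto)
      then show "(\<integral>\<^sup>+ v. ennreal (J (n0 + n) v * exp (\<theta> * X v)) \<partial>M) \<le> ennreal \<nu>"
        using \<theta>(2) by (simp add: ennreal_leI)
    qed
    finally show False using mgf[OF \<theta>(1)] by simp
  qed
  then obtain n \<theta> where n: "n0 \<le> n" and \<theta>: "0 \<le> \<theta>" "\<psi> n \<theta> = 0" "\<nu> < \<phi> n \<theta>" by blast
  show ?thesis
  proof (rule that[OF \<theta>(1)])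
    show "expectation (\<lambda>v. X v * (indicator {v. \<bar>X v\<bar> \<le> real n} v * exp (\<theta> * X v))) = 0"
      using \<theta>(2) by (simp add: \<psi>_def J_def mult.assoc)
    show "\<nu> < expectation (\<lambda>v. indicator {v. \<bar>X v\<bar> \<le> real n} v * exp (\<theta> * X v))"
      using \<theta>(3) by (simp add: \<phi>_def J_def)
    have "expectation (\<lambda>v. d * Q n v) \<le> expectation (\<lambda>v. \<bar>X v\<bar> * (J n v * exp (\<theta> * X v)))"
    proof (rule integral_mono)
      show "integrable M (\<lambda>v. \<bar>X v\<bar> * (J n v * exp (\<theta> * X v)))" by (rule wint) auto
      show "d * Q n v \<le> \<bar>X v\<bar> * (J n v * exp (\<theta> * X v))" for v
      proof (cases "Q n v = 0")
        case False
        then have dX: "d < X v" by (rule Q(3))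
        then have "1 \<le> exp (\<theta> * X v)" using \<theta>(1) d by simp
        then have "Q n v * 1 \<le> J n v * exp (\<theta> * X v)" using Q[of n v] J[of n v] by (intro mult_mono) auto
        then show ?thesis using dX d Q[of n v] by (intro mult_mono[of d]) auto
      qed (use J in simp)
    qed (use Qint in simp)
    moreover have "0 < d * expectation (Q n)" using n0[OF n] \<eta> d by simp
    ultimately show "0 < expectation (\<lambda>v. \<bar>X v\<bar> * (indicator {v. \<bar>X v\<bar> \<le> real n} v * exp (\<theta> * X v)))"
      by (simp add: J_def)
  qed
qed

text \<open>
  Because shifting \<open>x\<close> upwards only increases a nondecreasing function, the running supremum of a
  subsolution is again a subsolution.
\<close>

lemma monotone_envelope_subsolution:
  fixes X :: "'a \<Rightarrow> real" and w :: "real \<Rightarrow> real"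
  assumes [measurable]: "X \<in> borel_measurable M" "w \<in> borel_measurable borel"
    and w: "\<And>x. 0 \<le> w x" "\<And>x. w x \<le> C" "\<And>x. x \<le> 0 \<Longrightarrow> w x = 0"
    and K: "0 < K" "\<And>x. 0 < x \<Longrightarrow> x < K \<Longrightarrow> 0 < w x"
    and \<nu>: "0 < \<nu>" and sub: "\<And>x. \<nu> * w x \<le> expectation (\<lambda>v. w (x + X v))"
  obtains W :: "real \<Rightarrow> real" where "mono W" "\<And>x. x < 0 \<Longrightarrow> W x = 0" "\<And>x. 0 < x \<Longrightarrow> 0 < W x"
    "\<And>x. W x \<le> C" "\<And>x. \<nu> * W x \<le> expectation (\<lambda>v. W (x + X v))"
proof -
  define W where "W x = (SUP y\<in>{..x}. w y)" for x
  have bdd: "bdd_above (w ` {..x})" for x by (rule bdd_aboveI2[of _ _ C]) (rule w(2))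
  have le: "w y \<le> W x" if "y \<le> x" for x y
    unfolding W_def using that by (intro cSUP_upper bdd) auto
  have WC: "W x \<le> C" for x unfolding W_def by (intro cSUP_least w) auto
  have W0: "0 \<le> W x" for x using le[of x x] w(1)[of x] by simp
  have mono: "mono W"
    unfolding W_def by (intro monoI cSUP_subset_mono bdd) auto
  have [measurable]: "W \<in> borel_measurable borel" by (rule borel_measurable_mono[OF mono])
  have Wint: "integrable M (\<lambda>v. W (x + X v))" for x
    by (rule integrable_const_bound[of _ C]) (use W0 WC in auto)
  have wint: "integrable M (\<lambda>v. w (x + X v))" for x
    by (rule integrable_const_bound[of _ C]) (use w in auto)
  show ?thesis
  proof (rule that[OF mono _ _ WC])
    show "W x = 0" if "x < 0" for x
    proof -
      have "W x = (SUP y\<in>{..x}. 0)" unfolding W_def using that w(3) by (intro SUP_cong) auto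
      then show ?thesis by simp
    qed
    show "0 < W x" if "0 < x" for x
    proof -
      have "0 < w (min x (K / 2))" by (rule K(2)) (use that K(1) in auto)
      also have "\<dots> \<le> W x" by (rule le) simp
      finally show ?thesis .
    qed
    show "\<nu> * W x \<le> expectation (\<lambda>v. W (x + X v))" for x
    proof -
      have "w y \<le> expectation (\<lambda>v. W (x + X v)) / \<nu>" if "y \<le> x" for y
      proof -
        have "\<nu> * w y \<le> expectation (\<lambda>v. w (y + X v))" by (rule sub)
        also have "\<dots> \<le> expectation (\<lambda>v. W (x + X v))"
          by (rule integral_mono[OF wint Wint]) (use that in \<open>auto intro: le\<close>)
        finally show ?thesis using \<nu> by (simp add: field_simps)
      qed
      then have "W x \<le> expectation (\<lambda>v. W (x + X v)) / \<nu>"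
        unfolding W_def[of x] by (intro cSUP_least) auto
      then show ?thesis using \<nu> by (simp add: field_simps)
    qed
  qed
qed

lemma subsolution_negative_mean:
  fixes X :: "'a \<Rightarrow> real"
  assumes int: "integrable M X" and mean: "expectation X < 0"
    and pos: "0 < prob {v \<in> space M. 0 < X v}" and \<nu>: "0 < \<nu>"
    and mgf: "\<And>\<theta>. 0 \<le> \<theta> \<Longrightarrow> ennreal \<nu> < (\<integral>\<^sup>+ v. ennreal (exp (\<theta> * X v)) \<partial>M)"
  obtains W :: "real \<Rightarrow> real" and C where "mono W" "\<And>x. x < 0 \<Longrightarrow> W x = 0" "\<And>x. 0 < x \<Longrightarrow> 0 < W x"
    "\<And>x. W x \<le> C" "\<And>x. \<nu> * W x \<le> expectation (\<lambda>v. W (x + X v))"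
proof -
  have X [measurable]: "X \<in> borel_measurable M" using int by simp
  obtain \<theta> R where \<theta>: "0 \<le> \<theta>"
    "expectation (\<lambda>v. X v * (indicator {v. \<bar>X v\<bar> \<le> R} v * exp (\<theta> * X v))) = 0"
    "\<nu> < expectation (\<lambda>v. indicator {v. \<bar>X v\<bar> \<le> R} v * exp (\<theta> * X v))"
    "0 < expectation (\<lambda>v. \<bar>X v\<bar> * (indicator {v. \<bar>X v\<bar> \<le> R} v * exp (\<theta> * X v)))"
    using centring_tilt[OF int mean pos less_imp_le[OF \<nu>] mgf] by blast
  define g where "g v = indicator {v. \<bar>X v\<bar> \<le> R} v * exp (\<theta> * X v)" for v
  have g0: "0 \<le> g v" "g v \<le> exp (\<theta> * X v)" for v by (auto simp: g_def indicator_def)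
  have gint: "integrable M g"
  proof (rule integrable_const_bound[of _ "exp (\<theta> * R)"])
    show "AE v in M. norm (g v) \<le> exp (\<theta> * R)"
      using \<theta>(1) by (intro AE_I2) (auto simp: g_def indicator_def intro!: mult_left_mono)
  qed (unfold g_def, measurable)
  obtain K where K: "0 < K" and q: "\<And>x. \<nu> * max 0 (x * (K - x)) \<le>
      expectation (\<lambda>v. max 0 ((x + X v) * (K - (x + X v))) * g v)"
  proof (rule parabola_subsolution[OF X gint g0(1), of R \<nu>])
    show "\<bar>X v\<bar> \<le> R" if "g v \<noteq> 0" for v using that by (auto simp: g_def indicator_def split: if_splits)
  qed (use \<theta> in \<open>auto simp: g_def\<close>)
  define w where "w x = exp (\<theta> * x) * max 0 (x * (K - x))" for x
  have w0: "0 \<le> w x" for x by (simp add: w_def)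
  have wC: "w x \<le> exp (\<theta> * K) * (K * K)" for x
  proof (cases "0 \<le> x \<and> x \<le> K")
    case True
    then have "x * (K - x) \<le> K * K" using K by (intro mult_mono) auto
    moreover have "exp (\<theta> * x) \<le> exp (\<theta> * K)" using True \<theta>(1) by (simp add: mult_left_mono)
    ultimately show ?thesis unfolding w_def using K by (intro mult_mono) auto
  next
    case False
    then have "x * (K - x) \<le> 0" using K by (auto intro: mult_nonpos_nonneg mult_nonneg_nonpos)
    then have "w x = 0" by (simp add: w_def)
    then show ?thesis using K by simp
  qed
  have wmeas [measurable]: "w \<in> borel_measurable borel" unfolding w_def by measurable
  have wint: "integrable M (\<lambda>v. w (x + X v))" for x
    by (rule integrable_const_bound[of _ "exp (\<theta> * K) * (K * K)"]) (use w0 wC in auto)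
  have wzero: "w x = 0" if "x \<le> 0" for x
    using that K by (simp add: w_def mult_nonpos_nonneg)
  have wpos: "0 < w x" if "0 < x" "x < K" for x using that by (simp add: w_def)
  have wsub: "\<nu> * w x \<le> expectation (\<lambda>v. w (x + X v))" for x
  proof -
    have "\<nu> * w x \<le> exp (\<theta> * x) * expectation (\<lambda>v. max 0 ((x + X v) * (K - (x + X v))) * g v)"
      using mult_left_mono[OF q[of x], of "exp (\<theta> * x)"] by (simp add: w_def ac_simps)
    also have "\<dots> = expectation (\<lambda>v. exp (\<theta> * x) * (max 0 ((x + X v) * (K - (x + X v))) * g v))"
      by simp
    also have "\<dots> \<le> expectation (\<lambda>v. w (x + X v))"
    proof (rule integral_mono'[OF wint])
      fix v
      have "exp (\<theta> * x) * (max 0 ((x + X v) * (K - (x + X v))) * g v)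
          \<le> exp (\<theta> * x) * (max 0 ((x + X v) * (K - (x + X v))) * exp (\<theta> * X v))"
        using g0 by (intro mult_left_mono) auto
      also have "\<dots> = w (x + X v)" by (simp add: w_def distrib_left exp_add)
      finally show "exp (\<theta> * x) * (max 0 ((x + X v) * (K - (x + X v))) * g v) \<le> w (x + X v)" .
    qed (rule w0)
    finally show ?thesis .
  qed
  obtain W where "mono W" "\<And>x. x < 0 \<Longrightarrow> W x = 0" "\<And>x. 0 < x \<Longrightarrow> 0 < W x"
    "\<And>x. W x \<le> exp (\<theta> * K) * (K * K)" "\<And>x. \<nu> * W x \<le> expectation (\<lambda>v. W (x + X v))"
    using monotone_envelope_subsolution[OF X wmeas w0 wC wzero K wpos \<nu> wsub] by blast
  then show ?thesis by (rule that)
qed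

end

section \<open>The phase transition of the price\<close>

theorem theorem1:
  fixes p :: real
    and N :: "'v measure" and X :: "'v \<Rightarrow> real"
    and M :: "'w measure" and B :: "nat \<Rightarrow> 'w \<Rightarrow> book"
  assumes "0 \<le> p" and "p \<le> 1"
    and "prob_space N" and "X \<in> borel_measurable N"
    and "one_sided_lob_chain p N X M B"
    and "p > 1 / 2"
    and "integrable N X"
  shows "((\<integral>v. X v \<partial>N) > 0 \<longrightarrow>
            (AE \<omega> in M. filterlim (\<lambda>n. price (B n \<omega>)) at_top sequentially)) \<and>
         ((\<integral>v. X v \<partial>N) < 0 \<and> measure N {v \<in> space N. X v > 0} > 0 \<longrightarrow>
            (let a = (INF \<theta>\<in>{0::real..}. \<integral>\<^sup>+ v. ennreal (exp (\<theta> * X v)) \<partial>N) in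
               0 < a \<and> a \<le> 1 \<and>
               (p > 1 / (1 + enn2real a) \<longrightarrow>
                  (AE \<omega> in M. filterlim (\<lambda>n. price (B n \<omega>)) at_top sequentially)) \<and>
               (p < 1 / (1 + enn2real a) \<longrightarrow>
                  (AE \<omega> in M. filterlim (\<lambda>n. price (B n \<omega>)) at_bot sequentially))))"
proof -
  interpret lob_chain p N X M B
    using assms by (auto simp: lob_chain_def lob_chain_axioms_def one_sided_lob_chain_def)
  define L where "L \<theta> = (\<integral>\<^sup>+ v. ennreal (exp (\<theta> * X v)) \<partial>N)" for \<theta>
  define a where "a = (INF \<theta>\<in>{0::real..}. L \<theta>)"
  define r where "r = (1 - p) / p"
  have r: "0 \<le> r" "r < 1" using p_gt p_le by (auto simp: r_def)
  show ?thesis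
  proof (intro conjI impI)
    assume mean: "0 < (\<integral>v. X v \<partial>N)"
    have X_pos: "0 < measure N {v \<in> space N. 0 < X v}"
    proof (rule ccontr)
      assume "\<not> 0 < measure N {v \<in> space N. 0 < X v}"
      then have "measure N {v \<in> space N. 0 < X v} = 0" by (simp add: zero_less_measure_iff)
      then have "AE v in N. \<not> 0 < X v"
        by (intro AE_I[of _ _ "{v \<in> space N. 0 < X v}"]) (auto simp: N.emeasure_eq_measure)
      then have "AE v in N. X v \<le> 0" by eventually_elim simp
      then have "(\<integral>v. X v \<partial>N) \<le> (\<integral>v. 0 \<partial>N)"
        by (intro integral_mono_AE assms) auto
      then show False using mean by simp
    qed
    define \<nu> where "\<nu> = (1 + r) / 2"
    have \<nu>: "0 < \<nu>" "\<nu> < 1" "r < \<nu>" using r by (auto simp: \<nu>_def)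
    have p\<nu>: "1 - p < p * \<nu>" using \<nu>(3) p_gt by (simp add: r_def field_simps)
    obtain W C where W: "mono W" "\<And>x. x < 0 \<Longrightarrow> W x = 0" "\<And>x. 0 < x \<Longrightarrow> 0 < W x"
      "\<And>x. W x \<le> C" "\<And>x. \<nu> * W x \<le> (\<integral>v. W (x + X v) \<partial>N)"
      using N.subsolution_positive_mean[OF assms(7) mean \<nu>(1,2)] by blast
    show "AE \<omega> in M. filterlim (\<lambda>n. price (B n \<omega>)) at_top sequentially"
      by (rule price_at_top[OF W(1-4) p\<nu> W(5) X_pos])
  next
    assume "(\<integral>v. X v \<partial>N) < 0 \<and> measure N {v \<in> space N. X v > 0} > 0"
    then have mean: "(\<integral>v. X v \<partial>N) < 0" and X_pos: "0 < measure N {v \<in> space N. 0 < X v}" by auto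
    have "emeasure N {v \<in> space N. 0 < X v} \<le> L \<theta>" if "0 \<le> \<theta>" for \<theta>
    proof -
      have "(\<integral>\<^sup>+ v. indicator {v \<in> space N. 0 < X v} v \<partial>N) \<le> L \<theta>"
        unfolding L_def using that by (intro nn_integral_mono) (auto simp: indicator_def)
      then show ?thesis by simp
    qed
    then have "emeasure N {v \<in> space N. 0 < X v} \<le> a" unfolding a_def by (intro INF_greatest) auto
    moreover have "0 < emeasure N {v \<in> space N. 0 < X v}"
      using X_pos by (simp add: N.emeasure_eq_measure)
    ultimately have a0: "0 < a" by (rule less_le_trans[rotated])
    have "a \<le> L 0" unfolding a_def by (rule INF_lower) simp
    also have "L 0 = 1" by (simp add: L_def N.emeasure_space_1)
    finally have a1: "a \<le> 1" .
    have a_real: "ennreal (enn2real a) = a" using a1 by (simp add: le_less_trans)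
    have a_pos: "0 < enn2real a" using a0 a1 by (simp add: enn2real_positive_iff le_less_trans)
    have top: "AE \<omega> in M. filterlim (\<lambda>n. price (B n \<omega>)) at_top sequentially" if "p > 1 / (1 + enn2real a)"
    proof -
      have ra: "r < enn2real a" using that a_pos p_gt by (simp add: r_def field_simps)
      define \<nu> where "\<nu> = (r + enn2real a) / 2"
      have \<nu>: "0 < \<nu>" "r < \<nu>" "\<nu> < enn2real a" using r ra by (auto simp: \<nu>_def)
      have p\<nu>: "1 - p < p * \<nu>" using \<nu>(2) p_gt by (simp add: r_def field_simps)
      have mgf: "ennreal \<nu> < (\<integral>\<^sup>+ v. ennreal (exp (\<theta> * X v)) \<partial>N)" if "0 \<le> \<theta>" for \<theta>
      proof -
        have "ennreal \<nu> < ennreal (enn2real a)" using \<nu> by (simp add: ennreal_less_iff)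
        also have "\<dots> \<le> L \<theta>" unfolding a_real unfolding a_def using that by (intro INF_lower) simp
        finally show ?thesis by (simp add: L_def)
      qed
      obtain W C where W: "mono W" "\<And>x. x < 0 \<Longrightarrow> W x = 0" "\<And>x. 0 < x \<Longrightarrow> 0 < W x"
        "\<And>x. W x \<le> C" "\<And>x. \<nu> * W x \<le> (\<integral>v. W (x + X v) \<partial>N)"
        using N.subsolution_negative_mean[OF assms(7) mean X_pos \<nu>(1) mgf] by blast
      show ?thesis by (rule price_at_top[OF W(1-4) p\<nu> W(5) X_pos])
    qed
    have bot: "AE \<omega> in M. filterlim (\<lambda>n. price (B n \<omega>)) at_bot sequentially" if "p < 1 / (1 + enn2real a)"
    proof -
      have "enn2real a < r" using that a_pos p_gt by (simp add: r_def field_simps)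
      then have "a < ennreal r" using a_real a_pos by (metis ennreal_less_iff less_imp_le)
      then obtain \<theta> where \<theta>: "0 \<le> \<theta>" "L \<theta> < ennreal r" unfolding a_def by (auto simp: INF_less_iff)
      have "\<theta> \<noteq> 0"
      proof
        assume "\<theta> = 0"
        then have "1 < ennreal r" using \<theta>(2) by (simp add: L_def N.emeasure_space_1)
        then show False using r by (simp add: ennreal_less_iff[of 1, simplified])
      qed
      have int: "integrable N (\<lambda>v. exp (\<theta> * X v))"
        using \<theta>(2) by (intro integrableI_nonneg) (auto simp: L_def intro: less_trans)
      have "L \<theta> = ennreal (\<integral>v. exp (\<theta> * X v) \<partial>N)"
        unfolding L_def by (rule nn_integral_eq_integral[OF int]) simp
      then have "(\<integral>v. exp (\<theta> * X v) \<partial>N) < r" using \<theta>(2) by (simp add: ennreal_less_iff)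
      then have "p * (\<integral>v. exp (\<theta> * X v) \<partial>N) < 1 - p"
        using p_gt by (simp add: r_def field_simps)
      then show ?thesis using price_at_bot[OF _ int] \<theta>(1) \<open>\<theta> \<noteq> 0\<close> by simp
    qed
    show "let a = (INF \<theta>\<in>{0::real..}. \<integral>\<^sup>+ v. ennreal (exp (\<theta> * X v)) \<partial>N) in
               0 < a \<and> a \<le> 1 \<and>
               (p > 1 / (1 + enn2real a) \<longrightarrow>
                  (AE \<omega> in M. filterlim (\<lambda>n. price (B n \<omega>)) at_top sequentially)) \<and>
               (p < 1 / (1 + enn2real a) \<longrightarrow>
                  (AE \<omega> in M. filterlim (\<lambda>n. price (B n \<omega>)) at_bot sequentially))"
      using a0 a1 top bot unfolding Let_def a_def L_def by blast
  qed
qed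

end
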